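(* Let $\mathcal{A}\in\mathbb{C}^{n_1\times n_1\times n_3}$ and $\mathrm{Ind}(\mathcal{A})=k$. Then, for any $\{1\}$-inverse $(\mathcal{A}^{2k+1})^{(1)}$ of $\mathcal{A}^{2k+1}$, $$\mathcal{A}^D=\mathcal{A}^k*_c(\mathcal{A}^{2k+1})^{(1)}*_c\mathcal{A}^k.$$ In particular, $$\mathcal{A}^D=\mathcal{A}^k*_c(\mathcal{A}^{2k+1})^{\dagger}*_c\mathcal{A}^k.$$
   Context: For a third-order tensor $\mathcal{A}\in\mathbb{C}^{n_1\times n_2\times n_3}$, $\mathcal{A}^{(i)}=\mathcal{A}(:,:,i)\in\mathbb{C}^{n_1\times n_2}$ denotes its $i$-th frontal slice. Let $\mathbf{C}_{n_3}$ be the $n_3\times n_3$ orthogonal DCT matrix, with entries $(\mathbf{C}_{n_3})_{jk}=\sqrt{(2-\delta_{j1})/n_3}\,\cos\big(\tfrac{(j-1)(2k-1)\pi}{2n_3}\big)$; let $\mathbf{W}$ be the diagonal matrix whose diagonal is the first column of $\mathbf{C}_{n_3}$; let $\mathbf{Z}$ be the $n_3\times n_3$ matrix with ones on the first superdiagonal and zeros elsewhere; and put $\mathbf{M}=\mathbf{W}^{-1}\mathbf{C}_{n_3}(\mathbf{I}+\mathbf{Z})$, an invertible matrix. Define the linear bijection $L$ on tensors with third dimension $n_3$ by $L(\mathcal{A})_{ijk}=\sum_{l=1}^{n_3}\mathbf{M}_{kl}\mathcal{A}_{ijl}$. The C-product of $\mathcal{A}\in\mathbb{C}^{n_1\times n_2\times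 n_3}$ and $\mathcal{B}\in\mathbb{C}^{n_2\times l\times n_3}$ is the tensor $\mathcal{A}*_c\mathcal{B}\in\mathbb{C}^{n_1\times l\times n_3}$ determined by $L(\mathcal{A}*_c\mathcal{B})^{(i)}=L(\mathcal{A})^{(i)}L(\mathcal{B})^{(i)}$, $i=1,\dots,n_3$. The conjugate transpose $\mathcal{A}^H$ is determined by $L(\mathcal{A}^H)^{(i)}=(L(\mathcal{A})^{(i)})^H$ for all $i$. Powers $\mathcal{A}^k$ are with respect to $*_c$, with $\mathcal{A}^0=\mathcal{I}$ the identity tensor, determined by $L(\mathcal{I})^{(i)}=\mathbf{I}_{n_1}$ for all $i$. $\mathrm{mat}(\mathcal{A})$ is the $n_3\times n_3$ block Toeplitz-plus-Hankel matrix whose $(p,q)$ block is $\mathcal{A}^{(|p-q|+1)}+\mathbf{H}_{pq}$, where $\mathbf{H}_{pq}=\mathcal{A}^{(p+q)}$ if $p+q\le n_3$, $\mathbf{H}_{pq}=O$ if $p+q=n_3+1$, and $\mathbf{H}_{pq}=\mathcal{A}^{(2n_3+2-p-q)}$ if $p+q\ge n_3+2$. The index $\mathrm{Ind}(A)$ of a square matrix $A$ is the smallest nonnegative integer $k$ with $\mathrm{rank}(A^k)=\mathrm{rank}(A^{k+1})$, and $\mathrm{Ind}(\mathcal{A})=\mathrm{Ind}(\mathrm{mat}(\mathcal{A}))$. If $\mathrm{Ind}(\mathcal{A})=k$, the Drazin inverse $\mathcal{A}^D$ is the (unique) tensor $\mathcal{X}\in\mathbb{C}^{n_1\times n_1\times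 n_3}$ with $\mathcal{A}^{k+1}*_c\mathcal{X}=\mathcal{A}^k$, $\mathcal{X}*_c\mathcal{A}*_c\mathcal{X}=\mathcal{X}$, $\mathcal{A}*_c\mathcal{X}=\mathcal{X}*_c\mathcal{A}$. A $\{1\}$-inverse $\mathcal{B}^{(1)}$ of $\mathcal{B}$ is any tensor $\mathcal{X}$ with $\mathcal{B}*_c\mathcal{X}*_c\mathcal{B}=\mathcal{B}$. The Moore-Penrose inverse $\mathcal{B}^\dagger$ is the (unique) tensor $\mathcal{X}$ with $\mathcal{B}*_c\mathcal{X}*_c\mathcal{B}=\mathcal{B}$, $\mathcal{X}*_c\mathcal{B}*_c\mathcal{X}=\mathcal{X}$, $(\mathcal{B}*_c\mathcal{X})^H=\mathcal{B}*_c\mathcal{X}$, $(\mathcal{X}*_c\mathcal{B})^H=\mathcal{X}*_c\mathcal{B}$. *)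

theory Defs
  imports
    Complex_Main
    "Jordan_Normal_Form.Gauss_Jordan_Elimination"
    "Jordan_Normal_Form.Schur_Decomposition"
    "Jordan_Normal_Form.DL_Rank"
begin

text \<open>A third-order complex tensor is the list of its frontal slices.  Hence the dimensions of a
  tensor can be read off from it, and equality of tensors is equality of lists.\<close>

type_synonym tensor = "complex mat list"

definition tensors :: "nat \<Rightarrow> nat \<Rightarrow> nat \<Rightarrow> tensor set" where
  "tensors n1 n2 n3 = {A. length A = n3 \<and> set A \<subseteq> carrier_mat n1 n2}"

definition trows :: "tensor \<Rightarrow> nat" where
  "trows A = dim_row (A ! 0)"

definition tcols :: "tensor \<Rightarrow> nat" where
  "tcols A = dim_col (A ! 0)"

text \<open>Frontal slices are numbered from 1, matrix rows and columns from 0.\<close>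

definition slice :: "tensor \<Rightarrow> nat \<Rightarrow> complex mat" where
  "slice A i = A ! (i - 1)"

definition dct_mat :: "nat \<Rightarrow> complex mat" where
  "dct_mat n = mat n n (\<lambda>(j, k). complex_of_real
     (sqrt ((if j = 0 then 1 else 2) / real n)
      * cos (real j * (2 * real k + 1) * pi / (2 * real n))))"

definition W_mat :: "nat \<Rightarrow> complex mat" where
  "W_mat n = mat_diag n (\<lambda>j. dct_mat n $$ (j, 0))"

definition Z_mat :: "nat \<Rightarrow> complex mat" where
  "Z_mat n = mat n n (\<lambda>(i, j). if j = i + 1 then 1 else 0)"

definition M_mat :: "nat \<Rightarrow> complex mat" where
  "M_mat n = the (mat_inverse (W_mat n)) * dct_mat n * (1\<^sub>m n + Z_mat n)"

definition L_trans :: "tensor \<Rightarrow> tensor" where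
  "L_trans A = map (\<lambda>k. mat (trows A) (tcols A)
       (\<lambda>(i, j). \<Sum>l<length A. M_mat (length A) $$ (k, l) * (A ! l) $$ (i, j)))
     [0..<length A]"

text \<open>The operations below are specified through their image under \<open>L_trans\<close>.  Since
  \<open>M_mat n\<close> is invertible for \<open>n > 0\<close>, \<open>L_trans\<close> is a bijection on \<open>tensors n1 n2 n\<close>,
  so that the descriptions are proper.\<close>

definition cprod :: "tensor \<Rightarrow> tensor \<Rightarrow> tensor" (infixl \<open>*\<^sub>c\<close> 70) where
  "A *\<^sub>c B = (THE C. C \<in> tensors (trows A) (tcols B) (length A) \<and>
     (\<forall>i\<in>{1..length A}. slice (L_trans C) i = slice (L_trans A) i * slice (L_trans B) i))"

definition ctrans :: "tensor \<Rightarrow> tensor" where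
  "ctrans A = (THE C. C \<in> tensors (tcols A) (trows A) (length A) \<and>
     (\<forall>i\<in>{1..length A}. slice (L_trans C) i = mat_adjoint (slice (L_trans A) i)))"

definition tid :: "nat \<Rightarrow> nat \<Rightarrow> tensor" where
  "tid n n3 = (THE C. C \<in> tensors n n n3 \<and>
     (\<forall>i\<in>{1..n3}. slice (L_trans C) i = 1\<^sub>m n))"

primrec tpow :: "tensor \<Rightarrow> nat \<Rightarrow> tensor" (infixr \<open>^\<^sub>c\<close> 80) where
  "A ^\<^sub>c 0 = tid (trows A) (length A)"
| "A ^\<^sub>c Suc k = A ^\<^sub>c k *\<^sub>c A"

definition H_block :: "tensor \<Rightarrow> nat \<Rightarrow> nat \<Rightarrow> complex mat" where
  "H_block A p q = (let n3 = length A in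
     if p + q \<le> n3 then slice A (p + q)
     else if p + q = n3 + 1 then 0\<^sub>m (trows A) (tcols A)
     else slice A (2 * n3 + 2 - p - q))"

definition tmat_block :: "tensor \<Rightarrow> nat \<Rightarrow> nat \<Rightarrow> complex mat" where
  "tmat_block A p q = slice A (nat \<bar>int p - int q\<bar> + 1) + H_block A p q"

text \<open>The block Toeplitz-plus-Hankel matrix; block numbers start from 1.\<close>

definition tmat :: "tensor \<Rightarrow> complex mat" where
  "tmat A = mat (trows A * length A) (tcols A * length A)
     (\<lambda>(r, s). tmat_block A (r div trows A + 1) (s div tcols A + 1)
        $$ (r mod trows A, s mod tcols A))"

definition mat_index :: "complex mat \<Rightarrow> nat" where
  "mat_index B = (LEAST k.
     vec_space.rank (dim_row B) (B ^\<^sub>m k) = vec_space.rank (dim_row B) (B ^\<^sub>m (k + 1)))"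

definition tensor_index :: "tensor \<Rightarrow> nat" where
  "tensor_index A = mat_index (tmat A)"

definition is_drazin_inverse :: "tensor \<Rightarrow> tensor \<Rightarrow> bool" where
  "is_drazin_inverse A X \<longleftrightarrow> X \<in> tensors (trows A) (trows A) (length A) \<and>
     A ^\<^sub>c (tensor_index A + 1) *\<^sub>c X = A ^\<^sub>c tensor_index A \<and>
     X *\<^sub>c A *\<^sub>c X = X \<and>
     A *\<^sub>c X = X *\<^sub>c A"

definition drazin_inverse :: "tensor \<Rightarrow> tensor" where
  "drazin_inverse A = (THE X. is_drazin_inverse A X)"

definition is_one_inverse :: "tensor \<Rightarrow> tensor \<Rightarrow> bool" where
  "is_one_inverse B X \<longleftrightarrow> X \<in> tensors (tcols B) (trows B) (length B) \<and> B *\<^sub>c X *\<^sub>c B = B"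

definition is_mp_inverse :: "tensor \<Rightarrow> tensor \<Rightarrow> bool" where
  "is_mp_inverse B X \<longleftrightarrow> X \<in> tensors (tcols B) (trows B) (length B) \<and>
     B *\<^sub>c X *\<^sub>c B = B \<and>
     X *\<^sub>c B *\<^sub>c X = X \<and>
     ctrans (B *\<^sub>c X) = B *\<^sub>c X \<and>
     ctrans (X *\<^sub>c B) = X *\<^sub>c B"

definition mp_inverse :: "tensor \<Rightarrow> tensor" where
  "mp_inverse B = (THE X. is_mp_inverse B X)"

end

theory Submission
  imports Defs
begin

text \<open>The transform \<open>L_trans\<close> is a bijection that turns the C-product into the slicewise matrix product.
Square tensors thus form a monoid, with \<open>ctrans\<close> as involution, and equations between tensors
can be solved slice by slice.

The formula for the Drazin inverse is a fact about monoids (\<open>is_drazin_one_inverse\<close>): if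
\<open>a [^] k\<close> can be written as \<open>a [^] (k + 1) \<otimes> u\<close> and as \<open>v \<otimes> a [^] (k + 1)\<close>, then, by
iteration, \<open>a [^] k\<close> is a left and a right multiple of \<open>b = a [^] (2 * k + 1)\<close>.  In
\<open>a [^] k \<otimes> x \<otimes> a [^] k\<close> the factor \<open>b \<otimes> x \<otimes> b = b\<close> appears, which eliminates
\<open>x\<close>, and the Drazin equations follow.  Drazin inverses are unique in every monoid.

It remains to obtain the two factorisations from the index, which is defined by ranks of powers of
\<open>tmat A\<close>.  Equality of ranks gives \<open>tmat A ^ k = tmat A ^ (k + 1) * U\<close>
(\<open>factor_through_mult_of_rank_eq\<close>).  The rows of the cosine transform are common eigenvectors of
the scalar Toeplitz-plus-Hankel matrices, with the entries of \<open>M_mat\<close> as eigenvalues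
(\<open>sum_cos_toeplitz_hankel\<close>).  Hence there are matrices \<open>F\<close> with right inverses such that
\<open>F * tmat A\<close> is a transformed slice times \<open>F\<close> (\<open>dct_block_row_intertwines\<close>), and the
factorisation passes to each slice.  The factorisation from the other side is found on the slices
themselves: every square matrix has some power with such a factorisation, and its exponent can be
changed to \<open>k\<close> once the first factorisation is known (\<open>pow_eq_mult_pow_reduce\<close>).

The Moore-Penrose inverse is in particular an inner inverse, so the second formula is an instance of
the first once this inverse is known to exist uniquely.  Existence holds in a monoid with involution as soon as \<open>b = p \<otimes> (star b \<otimes> b)\<close>
and \<open>b = b \<otimes> star b \<otimes> q\<close> are solvable, and complex matrices admit such solutions because
\<open>mat_adjoint A * A * Y = 0\<close> forces \<open>A * Y = 0\<close>.\<close>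

section \<open>Drazin inverses in monoids\<close>

context monoid
begin

lemma pow_eq_pow_add_mult:
  assumes a: "a \<in> carrier G" and u: "u \<in> carrier G"
    and eq: "a [^] k = a [^] (k + 1) \<otimes> u"
  shows "a [^] k = a [^] (k + j) \<otimes> u [^] (j :: nat)"
proof (induction j)
  case 0
  show ?case using a u by simp
next
  case (Suc j)
  have "a [^] (k + j) = a [^] j \<otimes> a [^] k"
    using a by (simp add: nat_pow_mult add.commute)
  also have "\<dots> = a [^] j \<otimes> (a [^] (k + 1) \<otimes> u)"
    using eq by simp
  also have "\<dots> = a [^] (k + Suc j) \<otimes> u"
    using a u by (simp add: m_assoc[symmetric] nat_pow_mult add.commute del: nat_pow_Suc)
  finally have "a [^] k = a [^] (k + Suc j) \<otimes> u \<otimes> u [^] j"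
    using Suc by simp
  moreover have "u \<otimes> u [^] j = u [^] Suc j"
    using u by (metis nat_pow_Suc2)
  ultimately show ?case
    using a u by (simp add: m_assoc del: nat_pow_Suc)
qed

lemma pow_eq_mult_pow_add:
  assumes a: "a \<in> carrier G" and v: "v \<in> carrier G"
    and eq: "a [^] k = v \<otimes> a [^] (k + 1)"
  shows "a [^] k = v [^] (j :: nat) \<otimes> a [^] (k + j)"
proof (induction j)
  case 0
  show ?case using a v by simp
next
  case (Suc j)
  have "a [^] (k + j) = a [^] k \<otimes> a [^] j"
    using a by (simp add: nat_pow_mult)
  also have "\<dots> = v \<otimes> a [^] (k + 1) \<otimes> a [^] j"
    using eq by simp
  also have "\<dots> = v \<otimes> (a [^] (k + 1) \<otimes> a [^] j)"
    using a v by (simp add: m_assoc del: nat_pow_Suc)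
  also have "a [^] (k + 1) \<otimes> a [^] j = a [^] (k + Suc j)"
    unfolding nat_pow_mult[OF a] by simp
  finally show ?case
    using Suc a v by (simp add: m_assoc)
qed

text \<open>A left factorisation of some power \<open>a [^] m\<close> can be moved to the exponent \<open>k\<close> of a right
factorisation: iterating the latter writes \<open>a [^] k\<close> as \<open>a [^] m\<close> times something, and \<open>v\<close>
then acts on the factor \<open>a [^] m\<close>.  In this way the exponent of the left factorisation, about
which nothing is known, is replaced by \<open>k\<close>.\<close>

lemma pow_eq_mult_pow_reduce:
  assumes a: "a \<in> carrier G" and u: "u \<in> carrier G" and v: "v \<in> carrier G"
    and right: "a [^] k = a [^] (k + 1) \<otimes> u"
    and left: "a [^] m = v \<otimes> a [^] (m + 1 :: nat)"
  shows "a [^] k = v \<otimes> a [^] (k + 1 :: nat)"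
proof -
  have *: "a [^] k = a [^] m \<otimes> (a [^] k \<otimes> u [^] m)"
  proof -
    have "a [^] (k + m) = a [^] m \<otimes> a [^] k"
      using nat_pow_mult[OF a, of m k] by (simp add: add.commute)
    then show ?thesis
      using pow_eq_pow_add_mult[OF a u right, of m] a u by (metis m_assoc nat_pow_closed)
  qed
  also have "\<dots> = v \<otimes> a \<otimes> (a [^] m \<otimes> (a [^] k \<otimes> u [^] m))"
    unfolding left using a u v by (metis Suc_eq_plus1 left m_assoc m_closed nat_pow_Suc2 nat_pow_closed)
  also have "\<dots> = v \<otimes> a \<otimes> a [^] k"
    using * by simp
  also have "\<dots> = v \<otimes> a [^] (k + 1)"
    using a v by (metis Suc_eq_plus1 m_assoc nat_pow_Suc2 nat_pow_closed)
  finally show ?thesis .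
qed

definition is_drazin :: "nat \<Rightarrow> 'a \<Rightarrow> 'a \<Rightarrow> bool" where
  "is_drazin k a x \<longleftrightarrow> x \<in> carrier G \<and> a [^] (k + 1) \<otimes> x = a [^] k \<and>
     x \<otimes> a \<otimes> x = x \<and> a \<otimes> x = x \<otimes> a"

text \<open>Since \<open>x\<close> commutes with \<open>a\<close> and \<open>x \<otimes> a \<otimes> x = x\<close>, one has
\<open>x = x [^] (k + 1) \<otimes> a [^] k\<close>, and symmetrically for \<open>y\<close>.  Replacing \<open>a [^] k\<close>
by \<open>a [^] (k + 1) \<otimes> y\<close> on one side and by \<open>x \<otimes> a [^] (k + 1)\<close> on the other shows
that both elements equal \<open>x \<otimes> a \<otimes> y\<close>.\<close>

lemma is_drazin_unique:
  assumes a: "a \<in> carrier G" and x: "is_drazin k a x" and y: "is_drazin k a y"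
  shows "x = y"
proof -
  have xc: "x \<in> carrier G" and yc: "y \<in> carrier G"
    and xax: "x \<otimes> a \<otimes> x = x" and yay: "y \<otimes> a \<otimes> y = y"
    and ax: "a \<otimes> x = x \<otimes> a" and ay: "a \<otimes> y = y \<otimes> a"
    using x y by (auto simp: is_drazin_def)
  have comm: "a [^] (j :: nat) \<otimes> z = z \<otimes> a [^] j" if "z \<in> carrier G" "a \<otimes> z = z \<otimes> a" for z j
    using pow_mult_distrib a that by (metis group_commutes_pow)
  have red: "x [^] (j + 1) \<otimes> a [^] j = x" for j :: nat
  proof (induction j)
    case (Suc j)
    have "x [^] (Suc j + 1) \<otimes> a [^] Suc j = x \<otimes> a \<otimes> (x [^] (j + 1) \<otimes> a [^] j)"
    proof -
      have "x [^] (Suc j + 1) \<otimes> a [^] Suc j = x \<otimes> (x [^] (j + 1) \<otimes> (a \<otimes> a [^] j))"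
        using a xc by (metis Suc_eq_plus1 m_assoc nat_pow_Suc2 nat_pow_closed m_closed)
      also have "\<dots> = x \<otimes> (x [^] (j + 1) \<otimes> a \<otimes> a [^] j)"
        using a xc by (simp add: m_assoc del: nat_pow_Suc add_Suc_right)
      also have "x [^] (j + 1) \<otimes> a = a \<otimes> x [^] (j + 1)"
        using group_commutes_pow[OF ax[symmetric] xc a] .
      finally show ?thesis using a xc by (simp add: m_assoc del: nat_pow_Suc add_Suc_right)
    qed
    then show ?case using Suc xax by simp
  qed (use xc in simp)
  have red': "a [^] j \<otimes> y [^] (j + 1) = y" for j :: nat
  proof (induction j)
    case (Suc j)
    have "a [^] Suc j \<otimes> y [^] (Suc j + 1) = a [^] j \<otimes> (a \<otimes> y [^] (j + 1)) \<otimes> y"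
      using a yc by (simp add: m_assoc)
    also have "a \<otimes> y [^] (j + 1) = y [^] (j + 1) \<otimes> a"
      using group_commutes_pow[OF ay[symmetric] yc a, of "j + 1"] by simp
    also have "a [^] j \<otimes> (y [^] (j + 1) \<otimes> a) \<otimes> y = a [^] j \<otimes> y [^] (j + 1) \<otimes> a \<otimes> y"
      using a yc by (simp add: m_assoc del: nat_pow_Suc add_Suc_right)
    finally show ?case using Suc yay by simp
  qed (use yc in simp)
  have "x = x [^] (k + 1) \<otimes> a [^] k" by (simp only: red)
  also have "\<dots> = x [^] (k + 1) \<otimes> (a [^] k \<otimes> a \<otimes> y)"
    using y by (simp add: is_drazin_def)
  also have "\<dots> = x [^] (k + 1) \<otimes> a [^] k \<otimes> (a \<otimes> y)"
    using a xc yc by (simp add: m_assoc del: nat_pow_Suc add_Suc_right)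
  also have "\<dots> = x \<otimes> (a \<otimes> y)"
    by (simp only: red)
  finally have 1: "x = x \<otimes> (a \<otimes> y)" .
  have "y = a [^] k \<otimes> y [^] (k + 1)" by (simp only: red')
  also have "a [^] k = x \<otimes> a [^] (k + 1)"
    using x comm[OF xc ax, of "k + 1"] by (simp add: is_drazin_def del: nat_pow_Suc add_Suc_right)
  also have "x \<otimes> a [^] (k + 1) \<otimes> y [^] (k + 1) = x \<otimes> a \<otimes> (a [^] k \<otimes> y [^] (k + 1))"
    using a xc yc by (metis Suc_eq_plus1 m_assoc m_closed nat_pow_Suc2 nat_pow_closed)
  also have "\<dots> = x \<otimes> a \<otimes> y" by (simp only: red')
  finally have 2: "y = x \<otimes> a \<otimes> y" .
  show ?thesis using 1 2 a xc yc by (simp add: m_assoc)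
qed

text \<open>Write \<open>b\<close> for \<open>a [^] (2 * k + 1)\<close>.  Iterating the two factorisations gives
\<open>a [^] k = b \<otimes> q = p \<otimes> b\<close>, so that the inner inverse is absorbed:
\<open>a [^] k \<otimes> x \<otimes> a [^] k = p \<otimes> (b \<otimes> x \<otimes> b) \<otimes> q = p \<otimes> b \<otimes> q\<close>.
The result therefore equals both \<open>a [^] k \<otimes> q\<close> and \<open>p \<otimes> a [^] k\<close>, and the three
Drazin equations can be read off from these two forms.\<close>

lemma is_drazin_one_inverse:
  assumes a: "a \<in> carrier G" and u: "u \<in> carrier G" and v: "v \<in> carrier G"
    and x: "x \<in> carrier G"
    and right: "a [^] k = a [^] (k + 1) \<otimes> u"
    and left: "a [^] k = v \<otimes> a [^] (k + 1)"
    and inner: "a [^] (2 * k + 1) \<otimes> x \<otimes> a [^] (2 * k + 1) = a [^] (2 * k + 1)"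
  shows "is_drazin k a (a [^] k \<otimes> x \<otimes> a [^] k)"
proof -
  let ?b = "a [^] (2 * k + 1)" and ?d = "a [^] k \<otimes> x \<otimes> a [^] k"
  define p where "p = v [^] (k + 1)"
  define q where "q = u [^] (k + 1)"
  have pc: "p \<in> carrier G" and qc: "q \<in> carrier G" and bc: "?b \<in> carrier G"
    and kc: "a [^] k \<in> carrier G"
    using a u v by (simp_all add: p_def q_def)
  have kk: "k + (k + 1) = 2 * k + 1" by simp
  have bq: "a [^] k = ?b \<otimes> q"
    using pow_eq_pow_add_mult[OF a u right, of "k + 1"] unfolding q_def kk .
  have pb: "a [^] k = p \<otimes> ?b"
    using pow_eq_mult_pow_add[OF a v left, of "k + 1"] unfolding p_def kk .
  have comm: "a \<otimes> a [^] (j :: nat) = a [^] j \<otimes> a" for j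
    using a by (metis nat_pow_Suc nat_pow_Suc2)
  have "?d = p \<otimes> ?b \<otimes> x \<otimes> (?b \<otimes> q)"
    using bq pb by simp
  also have "\<dots> = p \<otimes> (?b \<otimes> x \<otimes> ?b) \<otimes> q"
    using pc qc bc x by (simp add: m_assoc del: nat_pow_Suc)
  finally have d: "?d = p \<otimes> ?b \<otimes> q"
    unfolding inner .
  then have d1: "?d = a [^] k \<otimes> q" unfolding pb[symmetric] .
  have d2: "?d = p \<otimes> a [^] k"
    using d pc qc bc bq by (simp add: m_assoc)
  have b_split: "a [^] (k + 1) \<otimes> a [^] k = ?b"
    unfolding nat_pow_mult[OF a] by (simp add: mult_2 del: nat_pow_Suc)
  have "a [^] (k + 1) \<otimes> ?d = a [^] (k + 1) \<otimes> a [^] k \<otimes> q"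
    unfolding d1 using a qc by (simp add: m_assoc)
  then have 1: "a [^] (k + 1) \<otimes> ?d = a [^] k"
    unfolding b_split bq[symmetric] .
  have "a \<otimes> ?d = a \<otimes> a [^] k \<otimes> q"
    unfolding d1 using a qc by (simp add: m_assoc)
  also have "\<dots> = p \<otimes> ?b \<otimes> a \<otimes> q"
    unfolding comm using pb by simp
  also have "\<dots> = p \<otimes> (a \<otimes> (?b \<otimes> q))"
    using a pc qc bc comm[of "2 * k + 1"] by (simp add: m_assoc[symmetric] del: nat_pow_Suc)
  also have "\<dots> = p \<otimes> a [^] k \<otimes> a"
    unfolding bq[symmetric] comm using a pc by (simp add: m_assoc)
  finally have 2: "a \<otimes> ?d = ?d \<otimes> a"
    unfolding d2 .
  have "?d \<otimes> a \<otimes> ?d = p \<otimes> a [^] k \<otimes> a \<otimes> (a [^] k \<otimes> q)"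
    using d1 d2 by simp
  also have "\<dots> = p \<otimes> (a [^] (k + 1) \<otimes> a [^] k) \<otimes> q"
    using a pc qc by (simp add: m_assoc)
  finally have 3: "?d \<otimes> a \<otimes> ?d = ?d"
    unfolding b_split d .
  show ?thesis
    unfolding is_drazin_def using 1 2 3 a x by simp
qed

end

section \<open>Moore-Penrose inverses in monoids with involution\<close>

locale star_monoid = monoid G for G (structure) +
  fixes star :: "'a \<Rightarrow> 'a"
  assumes star_closed [simp]: "x \<in> carrier G \<Longrightarrow> star x \<in> carrier G"
    and star_star [simp]: "x \<in> carrier G \<Longrightarrow> star (star x) = x"
    and star_mult: "x \<in> carrier G \<Longrightarrow> y \<in> carrier G \<Longrightarrow> star (x \<otimes> y) = star y \<otimes> star x"
begin

definition is_mp :: "'a \<Rightarrow> 'a \<Rightarrow> bool" where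
  "is_mp b x \<longleftrightarrow> x \<in> carrier G \<and> b \<otimes> x \<otimes> b = b \<and> x \<otimes> b \<otimes> x = x \<and>
     star (b \<otimes> x) = b \<otimes> x \<and> star (x \<otimes> b) = x \<otimes> b"

text \<open>Each of \<open>b \<otimes> x\<close> and \<open>b \<otimes> y\<close> absorbs the other on one side; as both are self-adjoint,
applying \<open>star\<close> to this relation makes them equal.  The same holds for \<open>x \<otimes> b\<close> and
\<open>y \<otimes> b\<close>.\<close>

lemma is_mp_unique:
  assumes b: "b \<in> carrier G" and x: "is_mp b x" and y: "is_mp b y"
  shows "x = y"
proof -
  have xc: "x \<in> carrier G" and yc: "y \<in> carrier G"
    using x y by (auto simp: is_mp_def)
  have "b \<otimes> x = star (b \<otimes> y \<otimes> (b \<otimes> x))"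
  proof -
    have "b \<otimes> y \<otimes> (b \<otimes> x) = b \<otimes> x"
      using y b xc yc by (simp add: is_mp_def m_assoc[symmetric])
    then show ?thesis using x by (simp add: is_mp_def)
  qed
  also have "\<dots> = b \<otimes> x \<otimes> (b \<otimes> y)"
    using x y b xc yc by (simp add: star_mult[of "b \<otimes> y"] is_mp_def)
  also have "\<dots> = b \<otimes> y"
    using x b xc yc by (simp add: is_mp_def m_assoc[symmetric])
  finally have 1: "b \<otimes> x = b \<otimes> y" .
  have "x \<otimes> b = star (x \<otimes> b \<otimes> (y \<otimes> b))"
  proof -
    have "x \<otimes> b \<otimes> (y \<otimes> b) = x \<otimes> (b \<otimes> y \<otimes> b)"
      using b xc yc by (simp add: m_assoc)
    also have "\<dots> = x \<otimes> b"
      using y by (simp add: is_mp_def)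
    finally show ?thesis using x by (simp add: is_mp_def)
  qed
  also have "\<dots> = y \<otimes> b \<otimes> (x \<otimes> b)"
    using x y b xc yc by (simp add: star_mult[of "x \<otimes> b"] is_mp_def)
  also have "\<dots> = y \<otimes> (b \<otimes> x \<otimes> b)"
    using b xc yc by (simp add: m_assoc)
  also have "\<dots> = y \<otimes> b"
    using x by (simp add: is_mp_def)
  finally have 2: "x \<otimes> b = y \<otimes> b" .
  have "x = x \<otimes> (b \<otimes> x)"
    using x b xc by (simp add: is_mp_def m_assoc)
  also have "\<dots> = x \<otimes> b \<otimes> y"
    using 1 b xc yc by (simp add: m_assoc)
  also have "\<dots> = y"
    using 2 y by (simp add: is_mp_def)
  finally show ?thesis .
qed

text \<open>The two factorisations make \<open>star p\<close> an inner inverse of \<open>b\<close> with \<open>b \<otimes> star p\<close>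
self-adjoint, and \<open>star q\<close> an inner inverse with \<open>star q \<otimes> b\<close> self-adjoint.  Multiplied by
\<open>b\<close> from the left or from the right, \<open>star q \<otimes> b \<otimes> star p\<close> gives
\<open>b \<otimes> star p\<close> or \<open>star q \<otimes> b\<close>, so it inherits both symmetries (Urquhart's formula).\<close>

lemma is_mp_of_star_regular:
  assumes b: "b \<in> carrier G" and p: "p \<in> carrier G" and q: "q \<in> carrier G"
    and left: "b = p \<otimes> (star b \<otimes> b)" and right: "b = b \<otimes> star b \<otimes> q"
  shows "is_mp b (star q \<otimes> b \<otimes> star p)"
proof -
  have sb: "star b = star b \<otimes> b \<otimes> star p"
    using arg_cong[OF left, of star] b p by (simp add: star_mult)
  have sb': "star b = star q \<otimes> (b \<otimes> star b)"
    using arg_cong[OF right, of star] b q by (simp add: star_mult)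
  have bp: "b \<otimes> star p = p \<otimes> star b"
  proof -
    have "b \<otimes> star p = p \<otimes> (star b \<otimes> b \<otimes> star p)"
      using arg_cong[OF left, of "\<lambda>z. z \<otimes> star p"] b p by (simp add: m_assoc)
    then show ?thesis using sb by simp
  qed
  have qb: "star q \<otimes> b = star b \<otimes> q"
  proof -
    have "star q \<otimes> b = star q \<otimes> (b \<otimes> star b) \<otimes> q"
      using arg_cong[OF right, of "\<lambda>z. star q \<otimes> z"] b q by (simp add: m_assoc)
    then show ?thesis using sb' by simp
  qed
  have bpb: "b \<otimes> star p \<otimes> b = b"
    using left b p by (simp add: bp m_assoc)
  have bqb: "b \<otimes> star q \<otimes> b = b"
    using right b q by (simp add: qb m_assoc)
  have bx: "b \<otimes> (star q \<otimes> b \<otimes> star p) = b \<otimes> star p"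
    using bqb b p q by (simp add: m_assoc[symmetric])
  have xb: "star q \<otimes> b \<otimes> star p \<otimes> b = star q \<otimes> b"
    using bpb b p q by (simp add: m_assoc)
  have "star q \<otimes> b \<otimes> (star q \<otimes> b \<otimes> star p) = star q \<otimes> b \<otimes> star p"
    using bx b p q by (simp add: m_assoc)
  moreover have "star (b \<otimes> star p) = b \<otimes> star p"
    using b p by (simp add: star_mult bp[symmetric])
  moreover have "star (star q \<otimes> b) = star q \<otimes> b"
    using b q by (simp add: star_mult qb[symmetric])
  ultimately show ?thesis
    unfolding is_mp_def bx xb using bpb b p q by simp
qed

end

section \<open>Rank and factorisation of matrix powers\<close>

context vec_space
begin

lemma cols_mult_subset_span:
  assumes P: "P \<in> carrier_mat n nc" and Q: "Q \<in> carrier_mat nc nc'"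
  shows "set (cols (P * Q)) \<subseteq> span (set (cols P))"
proof
  fix y assume "y \<in> set (cols (P * Q))"
  then obtain j where j: "j < nc'" "y = col (P * Q) j"
    using P Q by (auto simp: cols_def)
  then have "y = P *\<^sub>v col Q j"
    using P Q by auto
  then show "y \<in> span (set (cols P))"
    using col_space_eq[OF P] P Q j by (auto simp: col_space_def)
qed

text \<open>The column space of \<open>P * Q\<close> lies in that of \<open>P\<close>.  A maximal independent set of columns of
\<open>P * Q\<close> is thus independent in the column space of \<open>P\<close>, and if it has as many elements as
the dimension of that space, it is a basis of it.\<close>

lemma rank_mult_le:
  assumes P: "P \<in> carrier_mat n nc" and Q: "Q \<in> carrier_mat nc nc'"
  shows "rank (P * Q) \<le> rank P"
    and "rank (P * Q) = rank P \<Longrightarrow> span (set (cols (P * Q))) = span (set (cols P))"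
proof -
  let ?W = "span (set (cols P))" and ?C = "set (cols (P * Q))"
  have PQ: "P * Q \<in> carrier_mat n nc'" using P Q by simp
  have cP: "set (cols P) \<subseteq> carrier_vec n" using P cols_dim by blast
  have sub: "VectorSpace.subspace class_ring ?W V"
    using cP span_is_subspace by simp
  then have submod: "submodule class_ring ?W V"
    using cP span_is_submodule by simp
  interpret W: vectorspace class_ring "vs ?W"
    using sub subspace_is_vs by blast
  have fin: "W.fin_dim"
    by (rule fin_dim_span_cols[OF P])
  obtain S where S: "maximal S (\<lambda>T. T \<subseteq> ?C \<and> lin_indpt T)"
    using maximal_exists_superset[of ?C "\<lambda>T. T \<subseteq> ?C \<and> lin_indpt T" "{}"]
    by (auto simp: lin_dep_def)
  then have SC: "S \<subseteq> ?C" and li: "lin_indpt S"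
    by (auto simp: maximal_def)
  have CW: "?C \<subseteq> ?W" by (rule cols_mult_subset_span[OF P Q])
  with SC have SW: "S \<subseteq> ?W" by blast
  have liW: "W.lin_indpt S"
    using span_li_not_depend(2)[OF SW submod] li by simp
  have rankPQ: "rank (P * Q) = card S"
    by (rule rank_card_indpt[OF PQ S])
  have rankP: "rank P = W.dim"
    by (simp add: rank_def)
  show "rank (P * Q) \<le> rank P"
    unfolding rankPQ rankP using W.li_le_dim(2)[OF fin _ liW] SW by simp
  assume eq: "rank (P * Q) = rank P"
  have "W.basis S"
    using W.dim_li_is_basis[OF fin _ _ liW] SW SC eq finite_subset[OF SC]
    by (simp add: rankPQ rankP)
  then have "W.gen_set S"
    by (simp add: W.basis_def)
  then have "span S = ?W"
    using span_li_not_depend(1)[OF SW submod] by simp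
  moreover have "span S \<subseteq> span ?C"
    by (rule span_is_monotone[OF SC])
  moreover have "span ?C \<subseteq> ?W"
    using span_is_subset[OF CW submod] .
  ultimately show "span ?C = ?W" by blast
qed

text \<open>Equal ranks make the column spaces equal, so every column of \<open>P\<close> is \<open>P * Q\<close> applied to some
vector; these vectors are the columns of \<open>U\<close>.\<close>

lemma factor_through_mult_of_rank_eq:
  assumes P: "P \<in> carrier_mat n nc" and Q: "Q \<in> carrier_mat nc nc'"
    and eq: "rank (P * Q) = rank P"
  shows "\<exists>U \<in> carrier_mat nc' nc. P = P * Q * U"
proof -
  have PQ: "P * Q \<in> carrier_mat n nc'" using P Q by simp
  have "\<exists>x \<in> carrier_vec nc'. P * Q *\<^sub>v x = col P j" if "j < nc" for j
  proof -
    have "col P j \<in> set (cols P)" using that P by (auto simp: cols_def)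
    then have "col P j \<in> span (set (cols P))"
      using in_own_span[of "set (cols P)"] cols_dim[of P] P by auto
    then have "col P j \<in> col_space (P * Q)"
      using rank_mult_le(2)[OF P Q eq] by (simp add: col_space_def)
    then show ?thesis
      using col_space_eq[OF PQ] PQ Q by auto
  qed
  then obtain x where x: "\<And>j. j < nc \<Longrightarrow> x j \<in> carrier_vec nc' \<and> P * Q *\<^sub>v x j = col P j"
    by metis
  let ?U = "mat nc' nc (\<lambda>(i, j). x j $ i)"
  have "P = P * Q * ?U"
  proof (rule mat_col_eqI)
    fix j assume "j < dim_col (P * Q * ?U)"
    then have j: "j < nc" by simp
    have "col ?U j = x j"
      using x[OF j] j by (intro eq_vecI) auto
    then show "col P j = col (P * Q * ?U) j"
      using x[OF j] j col_mult2[OF PQ, of ?U nc j] by simp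
  qed (use P Q in auto)
  then show ?thesis by (intro bexI[of _ ?U]) auto
qed

end

lemma pow_mat_factor_of_rank_eq:
  fixes B :: "'a :: field mat"
  assumes B: "B \<in> carrier_mat n n"
    and eq: "vec_space.rank n (B ^\<^sub>m k) = vec_space.rank n (B ^\<^sub>m (k + 1))"
  shows "\<exists>U \<in> carrier_mat n n. B ^\<^sub>m k = B ^\<^sub>m (k + 1) * U"
  using vec_space.factor_through_mult_of_rank_eq[of "B ^\<^sub>m k" n n B n] eq B by auto

lemma ex_rank_pow_mat_eq:
  fixes B :: "'a :: field mat"
  assumes B: "B \<in> carrier_mat n n"
  shows "\<exists>k. vec_space.rank n (B ^\<^sub>m k) = vec_space.rank n (B ^\<^sub>m (k + 1))"
proof (rule ccontr)
  let ?r = "\<lambda>k. vec_space.rank n (B ^\<^sub>m k)"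
  assume no: "\<nexists>k. ?r k = ?r (k + 1)"
  have "?r (k + 1) < ?r k" for k
  proof -
    have "?r (k + 1) \<le> ?r k"
      using vec_space.rank_mult_le(1)[of "B ^\<^sub>m k" n n B n] B by simp
    moreover have "?r k \<noteq> ?r (k + 1)"
      using no by blast
    ultimately show ?thesis by linarith
  qed
  then have "?r k + k \<le> ?r 0" for k
  proof (induction k)
    case (Suc k)
    from Suc.IH[OF Suc.prems] Suc.prems[of k] show ?case by simp
  qed simp
  from this[of "?r 0 + 1"] show False by simp
qed

lemma pow_mat_Suc_left:
  fixes B :: "'a :: semiring_1 mat"
  assumes B: "B \<in> carrier_mat n n"
  shows "B ^\<^sub>m Suc k = B * B ^\<^sub>m k"
proof (induction k)
  case (Suc k)
  then show ?case
    using B assoc_mult_mat[OF B pow_carrier_mat[OF B] B, of k] by simp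
qed (use B in simp)

lemma transpose_pow_mat:
  fixes B :: "'a :: comm_semiring_1 mat"
  assumes B: "B \<in> carrier_mat n n"
  shows "(B ^\<^sub>m k)\<^sup>T = B\<^sup>T ^\<^sub>m k"
proof (induction k)
  case (Suc k)
  have "(B ^\<^sub>m Suc k)\<^sup>T = B\<^sup>T * B\<^sup>T ^\<^sub>m k"
    using Suc B transpose_mult[of "B ^\<^sub>m k" n n B n] by simp
  also have "\<dots> = B\<^sup>T ^\<^sub>m Suc k"
    using B pow_mat_Suc_left[of "B\<^sup>T" n k] by simp
  finally show ?case .
qed (use B in auto)

text \<open>Ranks of powers cannot decrease forever, which gives a right factorisation; the left one comes from
the transpose.  The exponents of the two statements are unrelated here.\<close>

lemma ex_pow_mat_factor:
  fixes B :: "'a :: field mat"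
  assumes B: "B \<in> carrier_mat n n"
  shows "\<exists>m. \<exists>U \<in> carrier_mat n n. B ^\<^sub>m m = B ^\<^sub>m (m + 1) * U"
    and "\<exists>m. \<exists>V \<in> carrier_mat n n. B ^\<^sub>m m = V * B ^\<^sub>m (m + 1)"
proof -
  have right: "\<exists>m. \<exists>U \<in> carrier_mat n n. B ^\<^sub>m m = B ^\<^sub>m (m + 1) * U"
    if B: "B \<in> carrier_mat n n" for B :: "'a mat"
    using ex_rank_pow_mat_eq[OF B] pow_mat_factor_of_rank_eq[OF B] by blast
  show "\<exists>m. \<exists>U \<in> carrier_mat n n. B ^\<^sub>m m = B ^\<^sub>m (m + 1) * U"
    by (rule right[OF B])
  from right[of "B\<^sup>T"] B obtain m U where U: "U \<in> carrier_mat n n"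
    and eq: "B\<^sup>T ^\<^sub>m m = B\<^sup>T ^\<^sub>m (m + 1) * U" by auto
  have "B ^\<^sub>m m = U\<^sup>T * B ^\<^sub>m (m + 1)"
  proof -
    have B': "B\<^sup>T \<in> carrier_mat n n" using B by simp
    have "B ^\<^sub>m m = (B\<^sup>T ^\<^sub>m m)\<^sup>T"
      using transpose_pow_mat[OF B'] by simp
    also have "\<dots> = (B\<^sup>T ^\<^sub>m (m + 1) * U)\<^sup>T"
      using eq by simp
    also have "\<dots> = U\<^sup>T * (B\<^sup>T ^\<^sub>m (m + 1))\<^sup>T"
      by (rule transpose_mult[OF pow_carrier_mat[OF B'] U])
    finally show ?thesis
      unfolding transpose_pow_mat[OF B'] by simp
  qed
  then show "\<exists>m. \<exists>V \<in> carrier_mat n n. B ^\<^sub>m m = V * B ^\<^sub>m (m + 1)"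
    using U by (intro exI[of _ m] bexI[of _ "U\<^sup>T"]) auto
qed

section \<open>Adjoints of complex matrices\<close>

lemma mat_adjoint_dim [simp]:
  "dim_row (mat_adjoint A) = dim_col A" "dim_col (mat_adjoint A) = dim_row A"
  by (simp_all add: mat_adjoint_def)

lemma mat_adjoint_carrier [simp]:
  "A \<in> carrier_mat n m \<Longrightarrow> mat_adjoint A \<in> carrier_mat m n"
  by (auto intro: carrier_matI)

lemma mat_adjoint_index [simp]:
  "i < dim_col A \<Longrightarrow> j < dim_row A \<Longrightarrow> mat_adjoint A $$ (i, j) = conjugate (A $$ (j, i))"
  by (simp add: mat_adjoint_def mat_of_rows_index)

lemma mat_adjoint_adjoint [simp]: "mat_adjoint (mat_adjoint A) = A"
  by (rule eq_matI) auto

lemma mat_adjoint_mult: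
  fixes A :: "complex mat"
  assumes A: "A \<in> carrier_mat n m" and B: "B \<in> carrier_mat m l"
  shows "mat_adjoint (A * B) = mat_adjoint B * mat_adjoint A"
  using assms by (intro eq_matI) (auto simp: scalar_prod_def mult.commute intro!: sum.cong)

text \<open>The diagonal entries of \<open>mat_adjoint A * A\<close> are the squared norms of the columns of \<open>A\<close>.\<close>

lemma adjoint_mult_eq_zeroD:
  fixes A :: "complex mat"
  assumes A: "A \<in> carrier_mat n m" and eq: "mat_adjoint A * A = 0\<^sub>m m m"
  shows "A = 0\<^sub>m n m"
proof (rule eq_matI)
  fix i j assume ij: "i < dim_row (0\<^sub>m n m)" "j < dim_col (0\<^sub>m n m)"
  have "0 = (mat_adjoint A * A) $$ (j, j)" using eq ij by simp
  also have "\<dots> = (\<Sum>r<n. cnj (A $$ (r, j)) * A $$ (r, j))"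
    using A ij by (auto simp: scalar_prod_def atLeast0LessThan intro!: sum.cong)
  also have "\<dots> = complex_of_real (\<Sum>r<n. (cmod (A $$ (r, j)))\<^sup>2)"
    by (auto simp: complex_norm_square mult.commute simp flip: of_real_power intro!: sum.cong)
  finally have "(\<Sum>r<n. (cmod (A $$ (r, j)))\<^sup>2) = 0" by (metis of_real_eq_0_iff)
  then show "A $$ (i, j) = 0\<^sub>m n m $$ (i, j)"
    using ij by (subst (asm) sum_nonneg_eq_0_iff) auto
qed (use A in auto)

lemma adjoint_mult_cancel:
  fixes A :: "complex mat"
  assumes A: "A \<in> carrier_mat n m" and Y: "Y \<in> carrier_mat m l"
    and eq: "mat_adjoint A * A * Y = 0\<^sub>m m l"
  shows "A * Y = 0\<^sub>m n l"
proof (rule adjoint_mult_eq_zeroD)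
  have "mat_adjoint (A * Y) * (A * Y) = mat_adjoint Y * (mat_adjoint A * A * Y)"
    using A Y by (simp add: mat_adjoint_mult[OF A Y] assoc_mult_mat[of _ l m _ n _ l]
        assoc_mult_mat[of _ m n A m Y l])
  then show "mat_adjoint (A * Y) * (A * Y) = 0\<^sub>m l l"
    using eq Y by simp
qed (use A Y in simp)

text \<open>For \<open>H = mat_adjoint A * A\<close> some power satisfies \<open>H ^ m = H ^ (m + 1) * U\<close>, that is,
\<open>H ^ m\<close> annihilates \<open>Y = 1 - H * U\<close>.  As \<open>H\<close> is self-adjoint, repeated cancellation of
adjoint factors lowers \<open>m\<close> until \<open>A * Y = 0\<close> remains, which says
\<open>A = A * mat_adjoint A * (A * U)\<close>.\<close>

lemma ex_star_regular_right:
  fixes A :: "complex mat"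
  assumes A: "A \<in> carrier_mat n n"
  shows "\<exists>Q \<in> carrier_mat n n. A = A * mat_adjoint A * Q"
proof -
  let ?H = "mat_adjoint A * A"
  have A': "mat_adjoint A \<in> carrier_mat n n" using A by (rule mat_adjoint_carrier)
  have H: "?H \<in> carrier_mat n n" using A' A by (rule mult_carrier_mat)
  have Hh: "mat_adjoint ?H = ?H" by (simp add: mat_adjoint_mult[OF A' A])
  obtain m U where U: "U \<in> carrier_mat n n" and eq: "?H ^\<^sub>m m = ?H ^\<^sub>m (m + 1) * U"
    using ex_pow_mat_factor(1)[OF H] by blast
  define Y where "Y = 1\<^sub>m n - ?H * U"
  have Y: "Y \<in> carrier_mat n n" unfolding Y_def by (intro minus_carrier_mat mult_carrier_mat[OF H U])
  have "?H ^\<^sub>m m * Y = ?H ^\<^sub>m m - ?H ^\<^sub>m m * (?H * U)"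
    unfolding Y_def using H U by (subst mult_minus_distrib_mat[of _ n n _ n]) auto
  also have "?H ^\<^sub>m m * (?H * U) = ?H ^\<^sub>m m"
    using H U eq by (simp add: assoc_mult_mat[of _ n n ?H n U n])
  finally have "?H ^\<^sub>m m * Y = 0\<^sub>m n n"
    using H by simp
  then have "A * Y = 0\<^sub>m n n"
  proof (induction m)
    case 0
    then show ?case using A Y H by simp
  next
    case (Suc m)
    show ?case
    proof (cases m)
      case 0
      then have "mat_adjoint A * A * Y = 0\<^sub>m n n"
        using Suc.prems H A by simp
      then show ?thesis by (rule adjoint_mult_cancel[OF A Y])
    next
      case (Suc j)
      let ?Z = "?H ^\<^sub>m j * Y"
      have Z: "?Z \<in> carrier_mat n n" by (rule mult_carrier_mat[OF pow_carrier_mat[OF H] Y])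
      have "?H ^\<^sub>m Suc m * Y = mat_adjoint ?H * ?H * ?Z"
        unfolding Hh Suc pow_mat_Suc_left[OF H] assoc_mult_mat[OF H H Z]
        using H Y by (simp add: assoc_mult_mat[of _ n n _ n _ n])
      then have "mat_adjoint ?H * ?H * ?Z = 0\<^sub>m n n"
        using Suc.prems by simp
      then have "?H * ?Z = 0\<^sub>m n n"
        by (rule adjoint_mult_cancel[OF H Z])
      then have "?H ^\<^sub>m m * Y = 0\<^sub>m n n"
        unfolding Suc pow_mat_Suc_left[OF H] using H Y by (simp add: assoc_mult_mat[of _ n n _ n _ n])
      then show ?thesis by (rule Suc.IH)
    qed
  qed
  moreover have "A * Y = A - A * (?H * U)"
    unfolding Y_def using A H U by (subst mult_minus_distrib_mat[of _ n n _ n]) auto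
  ultimately have "A - A * (?H * U) = 0\<^sub>m n n" by simp
  then have "A = A * (?H * U)"
  proof -
    have C: "A * (?H * U) \<in> carrier_mat n n" using A H U by simp
    have "A $$ (i, j) = (A * (?H * U)) $$ (i, j)" if "i < n" "j < n" for i j
      using arg_cong[OF \<open>A - A * (?H * U) = 0\<^sub>m n n\<close>, of "\<lambda>M. M $$ (i, j)"] that C
      by (simp del: index_mult_mat)
    then show ?thesis using A C by (intro eq_matI) (auto simp del: index_mult_mat)
  qed
  also have "\<dots> = A * mat_adjoint A * (A * U)"
    using A A' H U by (simp add: assoc_mult_mat[of _ n n _ n _ n])
  finally show ?thesis using A U by (intro bexI[of _ "A * U"]) auto
qed

lemma ex_star_regular_left:
  fixes A :: "complex mat"
  assumes A: "A \<in> carrier_mat n n"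
  shows "\<exists>P \<in> carrier_mat n n. A = P * (mat_adjoint A * A)"
proof -
  obtain Q where Q: "Q \<in> carrier_mat n n" and eq: "mat_adjoint A = mat_adjoint A * A * Q"
    using ex_star_regular_right[of "mat_adjoint A" n] A by auto
  have A': "mat_adjoint A \<in> carrier_mat n n" using A by (rule mat_adjoint_carrier)
  have "A = mat_adjoint (mat_adjoint A * A * Q)"
    using arg_cong[OF eq, of mat_adjoint] by simp
  also have "\<dots> = mat_adjoint Q * (mat_adjoint A * A)"
    by (simp add: mat_adjoint_mult[OF mult_carrier_mat[OF A' A] Q] mat_adjoint_mult[OF A' A])
  finally have "A = mat_adjoint Q * (mat_adjoint A * A)" .
  then show ?thesis using Q by (intro bexI[of _ "mat_adjoint Q"]) auto
qed

section \<open>The discrete cosine transform\<close>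

text \<open>With \<open>a = m * pi / (2 * n)\<close> the terms are \<open>cos ((2 * k + 1) * a)\<close>, and multiplication by
\<open>2 * sin a\<close>, which is nonzero in the given range of \<open>m\<close>, turns the sum into a telescoping
one with value \<open>sin (m * pi) = 0\<close>.\<close>

lemma sum_cos_odd_multiples:
  fixes m :: int and n :: nat
  assumes n: "n > 0" and m: "m \<noteq> 0" "\<bar>m\<bar> < 2 * int n"
  shows "(\<Sum>k<n. cos (m * (2 * real k + 1) * pi / (2 * n))) = 0"
proof -
  define a where "a = m * pi / (2 * real n)"
  have arg: "m * (2 * real k + 1) * pi / (2 * n) = (2 * real k + 1) * a" for k
    by (simp add: a_def)
  have "sin a \<noteq> 0"
  proof
    assume "sin a = 0"
    then obtain i :: int where "a = i * pi"
      by (auto simp: sin_zero_iff_int2)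
    then have "real_of_int m * pi = (2 * real n * real_of_int i) * pi"
      using n by (simp add: a_def nonzero_divide_eq_eq mult_ac)
    then have "real_of_int m = real_of_int (2 * int n * i)"
      unfolding mult_cancel_right by simp
    then have mi: "m = 2 * int n * i"
      by (simp only: of_int_eq_iff)
    then have "i \<noteq> 0" using m by auto
    then have "\<bar>m\<bar> \<ge> 2 * int n"
      unfolding mi abs_mult using n mult_left_mono[of 1 "\<bar>i\<bar>" "2 * int n"] by simp
    then show False using m by simp
  qed
  have step: "2 * sin a * cos ((2 * real k + 1) * a) = sin (2 * real (Suc k) * a) - sin (2 * real k * a)" for k
    using sin_diff_sin[of "2 * real (Suc k) * a" "2 * real k * a"]
    by (simp add: algebra_simps add_divide_distrib diff_divide_distrib)
  have "2 * sin a * (\<Sum>k<n. cos ((2 * real k + 1) * a)) = (\<Sum>k<n. sin (2 * real (Suc k) * a) - sin (2 * real k * a))"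
    by (simp only: sum_distrib_left step)
  also have "\<dots> = sin (2 * real n * a)"
    by (subst sum_lessThan_telescope) simp
  also have "\<dots> = 0"
    using n by (simp add: a_def sin_zero_iff_int2)
  finally show ?thesis
    unfolding arg using \<open>sin a \<noteq> 0\<close> by simp
qed

lemma dct_mat_carrier [simp]: "dct_mat n \<in> carrier_mat n n"
  by (simp add: dct_mat_def)

text \<open>By the product-to-sum formula, the inner product of rows \<open>i\<close> and \<open>j\<close> splits into two sums of
cosines with frequencies \<open>i - j\<close> and \<open>i + j\<close>, which vanish unless the frequency is 0.\<close>

lemma dct_mat_orthogonal:
  assumes n: "n > 0"
  shows "dct_mat n * (dct_mat n)\<^sup>T = 1\<^sub>m n"
proof (rule eq_matI)
  fix i j assume "i < dim_row (1\<^sub>m n :: complex mat)" "j < dim_col (1\<^sub>m n :: complex mat)"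
  then have i: "i < n" and j: "j < n" by simp_all
  let ?s = "\<lambda>j. sqrt ((if j = 0 then 1 else 2) / real n)"
  let ?c = "\<lambda>(j :: real) k. cos (j * (2 * real k + 1) * pi / (2 * real n))"
  have prod: "?c i k * ?c j k = (?c (int i - int j) k + ?c (int i + int j) k) / 2" for k
    by (subst cos_times_cos) (simp add: algebra_simps add_divide_distrib diff_divide_distrib)
  have S: "(\<Sum>k<n. ?c i k * ?c j k) = (if i = j then if j = 0 then n else n / 2 else 0)"
    unfolding prod sum_divide_distrib[symmetric] sum.distrib
    using sum_cos_odd_multiples[OF n, of "int i - int j"] sum_cos_odd_multiples[OF n, of "int i + int j"] i j
    by auto
  have "(dct_mat n * (dct_mat n)\<^sup>T) $$ (i, j) = (\<Sum>k<n. complex_of_real (?s i * ?c i k) * complex_of_real (?s j * ?c j k))"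
    using i j by (auto simp: dct_mat_def scalar_prod_def atLeast0LessThan intro!: sum.cong)
  also have "\<dots> = complex_of_real (?s i * ?s j * (\<Sum>k<n. ?c i k * ?c j k))"
    by (simp add: sum_distrib_left mult_ac)
  also have "\<dots> = 1\<^sub>m n $$ (i, j)"
  proof -
    have "?s i * ?s j * (if i = j then if j = 0 then real n else real n / 2 else 0) = (if i = j then 1 else 0)"
    proof (cases "i = j")
      case True
      have sq: "?s j * ?s j = (if j = 0 then 1 else 2) / real n"
        by (rule real_sqrt_mult_self[THEN trans]) simp
      have "?s j * ?s j * (if j = 0 then real n else real n / 2) = 1"
        unfolding sq using n by (cases "j = 0") auto
      then show ?thesis unfolding True if_P[OF refl] .
    qed simp
    then have "complex_of_real (?s i * ?s j * (if i = j then if j = 0 then real n else real n / 2 else 0))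
        = complex_of_real (if i = j then 1 else 0)"
      by (rule arg_cong)
    also have "\<dots> = 1\<^sub>m n $$ (i, j)"
      using i j by simp
    finally show ?thesis unfolding S .
  qed
  finally show "(dct_mat n * (dct_mat n)\<^sup>T) $$ (i, j) = 1\<^sub>m n $$ (i, j)" .
qed (simp_all add: dct_mat_def)

lemma cos_half_range_pos:
  assumes "j < n"
  shows "cos (real j * pi / (2 * real n)) > 0"
proof (rule cos_gt_zero_pi)
  have "real j * pi < real n * pi" using assms by simp
  then show "real j * pi / (2 * real n) < pi / 2"
    using assms by (simp add: field_simps)
  have "0 \<le> real j * pi / (2 * real n)" by simp
  then show "- (pi / 2) < real j * pi / (2 * real n)"
    using pi_gt_zero by linarith
qed

lemma dct_mat_col_0_nonzero:
  assumes j: "j < n"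
  shows "dct_mat n $$ (j, 0) \<noteq> 0"
  using cos_half_range_pos[OF j] j by (simp add: dct_mat_def)

lemma mat_inverse_diag:
  fixes f :: "nat \<Rightarrow> 'a :: field"
  assumes nz: "\<And>i. i < n \<Longrightarrow> f i \<noteq> 0"
  shows "mat_inverse (mat_diag n f) = Some (mat_diag n (\<lambda>i. inverse (f i)))"
proof -
  let ?W = "mat_diag n f" and ?V = "mat_diag n (\<lambda>i. inverse (f i))"
  have carr: "?W \<in> carrier_mat n n" "?V \<in> carrier_mat n n" by simp_all
  have inv: "?V * ?W = 1\<^sub>m n" "?W * ?V = 1\<^sub>m n"
    unfolding mat_diag_diag using nz by (auto intro!: eq_matI simp: mat_diag_def)
  then have "?W \<in> Units (ring_mat TYPE('a) n ())"
    using carr unfolding Units_def ring_mat_simps by blast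
  then obtain B where B: "mat_inverse ?W = Some B"
    using mat_inverse(1)[OF carr(1), of "()"] by (cases "mat_inverse ?W") auto
  then have B': "?W * B = 1\<^sub>m n" "B \<in> carrier_mat n n"
    using mat_inverse(2)[OF carr(1) B] by auto
  have "B = ?V * ?W * B"
    unfolding inv using B' by simp
  also have "\<dots> = ?V * (?W * B)"
    by (rule assoc_mult_mat[OF carr(2,1) B'(2)])
  also have "\<dots> = ?V"
    unfolding B'(1) by (rule right_mult_one_mat[OF carr(2)])
  finally show ?thesis using B by simp
qed

text \<open>The DCT matrix with each row divided by its entry in the first column.  This cancels the
normalising factors \<open>sqrt ((2 - \<delta>) / n)\<close> and gives the first column the value 1.\<close>

definition dct_rows :: "nat \<Rightarrow> complex mat" where
  "dct_rows n = mat n n (\<lambda>(i, q). complex_of_real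
     (cos (real i * (2 * real q + 1) * pi / (2 * real n)) / cos (real i * pi / (2 * real n))))"

lemma dct_rows_carrier [simp]: "dct_rows n \<in> carrier_mat n n"
  by (simp add: dct_rows_def)

lemma W_inverse_dct:
  "the (mat_inverse (W_mat n)) * dct_mat n = dct_rows n"
proof -
  have "the (mat_inverse (W_mat n)) = mat_diag n (\<lambda>j. inverse (dct_mat n $$ (j, 0)))"
    unfolding W_mat_def by (subst mat_inverse_diag) (auto simp: dct_mat_col_0_nonzero)
  moreover have "mat_diag n (\<lambda>j. inverse (dct_mat n $$ (j, 0))) * dct_mat n = dct_rows n"
  proof (rule eq_matI)
    fix i q assume "i < dim_row (dct_rows n)" "q < dim_col (dct_rows n)"
    then have iq: "i < n" "q < n" by (simp_all add: dct_rows_def)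
    then have "(mat_diag n (\<lambda>j. inverse (dct_mat n $$ (j, 0))) * dct_mat n) $$ (i, q)
        = inverse (dct_mat n $$ (i, 0)) * dct_mat n $$ (i, q)"
      by (simp add: mat_diag_mult_left[of _ n n])
    also have "\<dots> = dct_rows n $$ (i, q)"
    proof -
      have cancel: "inverse (s * a) * (s * b) = b / a" if "s \<noteq> 0" for s a b :: real
        using that by (simp add: divide_inverse)
      let ?s = "sqrt ((if i = 0 then 1 else 2) / real n)"
      have "?s \<noteq> 0" using iq by simp
      have "inverse (dct_mat n $$ (i, 0)) * dct_mat n $$ (i, q)
          = complex_of_real (inverse (?s * cos (real i * pi / (2 * real n)))
              * (?s * cos (real i * (2 * real q + 1) * pi / (2 * real n))))"
        using iq by (simp add: dct_mat_def)
      then show ?thesis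
        unfolding cancel[OF \<open>?s \<noteq> 0\<close>] using iq by (simp add: dct_rows_def)
    qed
    finally show "(mat_diag n (\<lambda>j. inverse (dct_mat n $$ (j, 0))) * dct_mat n) $$ (i, q) = dct_rows n $$ (i, q)" .
  qed (simp_all add: carrier_matD[OF dct_mat_carrier] carrier_matD[OF dct_rows_carrier] mat_diag_def)
  ultimately show ?thesis by simp
qed

lemma M_mat_eq: "M_mat n = dct_rows n * (1\<^sub>m n + Z_mat n)"
  by (simp add: M_mat_def W_inverse_dct)

lemma Z_mat_carrier [simp]: "Z_mat n \<in> carrier_mat n n"
  by (simp add: Z_mat_def)

lemma M_mat_carrier [simp]: "M_mat n \<in> carrier_mat n n"
  unfolding M_mat_eq by (rule mult_carrier_mat[of _ n n]) auto

text \<open>Multiplication by \<open>1 + Z\<close> adds neighbouring columns, and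
\<open>cos (t + h) + cos (t - h) = 2 * cos t * cos h\<close>, where \<open>cos h\<close> is the denominator of the
row.\<close>

lemma M_mat_index:
  assumes k: "k < n" and l: "l < n"
  shows "M_mat n $$ (k, l) = complex_of_real ((if l = 0 then 1 else 2) * cos (real k * real l * pi / real n))"
proof -
  have IZ: "(1\<^sub>m n + Z_mat n) $$ (q, l) = (if q = l then 1 else 0) + (if l \<noteq> 0 \<and> q = l - 1 then 1 else 0)" if "q < n" for q
    using that l by (auto simp: Z_mat_def)
  have "M_mat n $$ (k, l) = (\<Sum>q<n. dct_rows n $$ (k, q) * (1\<^sub>m n + Z_mat n) $$ (q, l))"
    using k l by (auto simp: M_mat_eq scalar_prod_def atLeast0LessThan dct_rows_def Z_mat_def intro!: sum.cong)
  also have "\<dots> = (\<Sum>q<n. (if q = l then dct_rows n $$ (k, q) else 0)) + (\<Sum>q<n. if q = l - 1 then (if l \<noteq> 0 then dct_rows n $$ (k, q) else 0) else 0)"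
    unfolding sum.distrib[symmetric] by (intro sum.cong refl) (simp add: IZ del: index_add_mat)
  also have "\<dots> = dct_rows n $$ (k, l) + (if l \<noteq> 0 then dct_rows n $$ (k, l - 1) else 0)"
    using l by (simp add: sum.delta')
  also have "\<dots> = complex_of_real ((if l = 0 then 1 else 2) * cos (real k * real l * pi / real n))"
  proof (cases "l = 0")
    case True
    then show ?thesis using k cos_half_range_pos[OF k] by (simp add: dct_rows_def)
  next
    case False
    let ?h = "real k * pi / (2 * real n)" and ?t = "real k * real l * pi / real n"
    have a: "real k * (2 * real l + 1) * pi / (2 * real n) = ?t + ?h"
      by (simp add: add_divide_distrib algebra_simps)
    have b: "real k * (2 * real (l - 1) + 1) * pi / (2 * real n) = ?t - ?h"
      using False by (simp add: add_divide_distrib diff_divide_distrib algebra_simps of_nat_diff)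
    have "cos (?t + ?h) + cos (?t - ?h) = 2 * cos ?t * cos ?h"
      by (simp add: cos_add cos_diff)
    then have sum: "cos (?t + ?h) / cos ?h + cos (?t - ?h) / cos ?h = 2 * cos ?t"
      using cos_half_range_pos[OF k] by (simp add: add_divide_distrib[symmetric])
    have "dct_rows n $$ (k, l) = complex_of_real (cos (?t + ?h) / cos ?h)"
      unfolding dct_rows_def using k l by (simp only: index_mat prod.case a)
    moreover have "dct_rows n $$ (k, l - 1) = complex_of_real (cos (?t - ?h) / cos ?h)"
    proof -
      have "l - 1 < n" using l by simp
      then show ?thesis
        unfolding dct_rows_def using k by (simp only: index_mat prod.case b)
    qed
    ultimately have "dct_rows n $$ (k, l) + dct_rows n $$ (k, l - 1) = complex_of_real (2 * cos ?t)"
      unfolding sum[symmetric] by (simp only: of_real_add)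
    then show ?thesis
      using False by simp
  qed
  finally show ?thesis .
qed

text \<open>All three factors of \<open>M_mat\<close> have nonzero determinant: an inverse matrix, an orthogonal matrix
and an upper triangular matrix with unit diagonal.\<close>

lemma M_mat_invertible:
  assumes n: "n > 0"
  shows "\<exists>N \<in> carrier_mat n n. N * M_mat n = 1\<^sub>m n \<and> M_mat n * N = 1\<^sub>m n"
proof -
  have W: "W_mat n \<in> carrier_mat n n" by (simp add: W_mat_def)
  let ?IZ = "1\<^sub>m n + Z_mat n"
  have "det ?IZ = prod_list (diag_mat ?IZ)"
    by (rule det_upper_triangular[of _ n]) (auto simp: upper_triangular_def Z_mat_def)
  also have "\<dots> = 1"
    by (rule prod_list_neutral) (auto simp: diag_mat_def Z_mat_def)
  finally have "det ?IZ \<noteq> 0" by simp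
  have "det (dct_mat n) * det ((dct_mat n)\<^sup>T) = 1"
    using dct_mat_orthogonal[OF n] by (metis det_mult det_one dct_mat_carrier transpose_carrier_mat)
  then have "det (dct_mat n) \<noteq> 0" by auto
  let ?V = "mat_diag n (\<lambda>j. inverse (dct_mat n $$ (j, 0)))"
  have inv: "mat_inverse (W_mat n) = Some ?V"
    unfolding W_mat_def by (rule mat_inverse_diag) (rule dct_mat_col_0_nonzero)
  then have V: "?V * W_mat n = 1\<^sub>m n" "?V \<in> carrier_mat n n"
    using mat_inverse(2)[OF W inv] by auto
  then have "det ?V * det (W_mat n) = 1"
    using det_mult[OF V(2) W] by simp
  then have "det ?V \<noteq> 0" by auto
  have "det (M_mat n) = det ?V * det (dct_mat n) * det ?IZ"
    unfolding M_mat_def inv option.sel using V(2)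
    using det_mult[OF mult_carrier_mat[OF V(2) dct_mat_carrier], of ?IZ]
      det_mult[OF V(2) dct_mat_carrier] by simp
  then have "det (M_mat n) \<noteq> 0"
    using \<open>det ?IZ \<noteq> 0\<close> \<open>det (dct_mat n) \<noteq> 0\<close> \<open>det ?V \<noteq> 0\<close> by simp
  then have "M_mat n \<in> Units (ring_mat TYPE(complex) n ())"
    by (rule det_non_zero_imp_unit[OF M_mat_carrier])
  then show ?thesis
    by (auto simp: Units_def ring_mat_simps)
qed

section \<open>Tensors and their transformed slices\<close>

lemma tensorsD:
  assumes "A \<in> tensors n m n3"
  shows "length A = n3" and "l < n3 \<Longrightarrow> A ! l \<in> carrier_mat n m"
  using assms nth_mem[of l A] by (auto simp: tensors_def)

lemma trows_tensor: "A \<in> tensors n m n3 \<Longrightarrow> n3 > 0 \<Longrightarrow> trows A = n"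
  and tcols_tensor: "A \<in> tensors n m n3 \<Longrightarrow> n3 > 0 \<Longrightarrow> tcols A = m"
  using tensorsD(2)[of A n m n3 0] by (auto simp: trows_def tcols_def)

lemma tensor_eqI:
  assumes A: "A \<in> tensors n m n3" and B: "B \<in> tensors n m n3"
    and eq: "\<And>l i j. l < n3 \<Longrightarrow> i < n \<Longrightarrow> j < m \<Longrightarrow> A ! l $$ (i, j) = B ! l $$ (i, j)"
  shows "A = B"
proof (rule nth_equalityI)
  show "length A = length B" using A B by (simp add: tensorsD)
  fix l assume "l < length A"
  then have l: "l < n3" using tensorsD(1)[OF A] by simp
  show "A ! l = B ! l"
    using tensorsD(2)[OF A l] tensorsD(2)[OF B l] eq[OF l] by (intro eq_matI) auto
qed

text \<open>Application of a matrix along the third mode.  Composition of such maps is matrix multiplication, so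
that \<open>L_trans\<close>, the case of \<open>M_mat\<close>, is inverted by the inverse matrix.\<close>

definition mix_slices :: "complex mat \<Rightarrow> tensor \<Rightarrow> tensor" where
  "mix_slices N A = map (\<lambda>k. mat (trows A) (tcols A)
       (\<lambda>(i, j). \<Sum>l<length A. N $$ (k, l) * (A ! l) $$ (i, j))) [0..<length A]"

lemma mix_slices_in:
  assumes "A \<in> tensors n m n3" and "n3 > 0"
  shows "mix_slices N A \<in> tensors n m n3"
  using assms trows_tensor[OF assms] tcols_tensor[OF assms]
  by (auto simp: mix_slices_def tensors_def)

lemma mix_slices_index:
  assumes A: "A \<in> tensors n m n3" and "k < n3" "i < n" "j < m"
  shows "mix_slices N A ! k $$ (i, j) = (\<Sum>l<n3. N $$ (k, l) * A ! l $$ (i, j))"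
  using assms trows_tensor[OF A] tcols_tensor[OF A] tensorsD(1)[OF A]
  by (auto simp: mix_slices_def)

lemma mix_slices_mix_slices:
  assumes A: "A \<in> tensors n m n3" and n3: "n3 > 0"
    and N: "N \<in> carrier_mat n3 n3" and N': "N' \<in> carrier_mat n3 n3"
  shows "mix_slices N (mix_slices N' A) = mix_slices (N * N') A"
proof (rule tensor_eqI)
  note A' = mix_slices_in[OF A n3]
  show "mix_slices N (mix_slices N' A) \<in> tensors n m n3" "mix_slices (N * N') A \<in> tensors n m n3"
    by (rule mix_slices_in[OF A' n3], rule A')
  fix k i j assume k: "k < n3" and i: "i < n" and j: "j < m"
  have "mix_slices N (mix_slices N' A) ! k $$ (i, j)
      = (\<Sum>l<n3. N $$ (k, l) * (\<Sum>q<n3. N' $$ (l, q) * A ! q $$ (i, j)))"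
    using mix_slices_index[OF A _ i j] by (simp add: mix_slices_index[OF A' k i j])
  also have "\<dots> = (\<Sum>q<n3. \<Sum>l<n3. N $$ (k, l) * N' $$ (l, q) * A ! q $$ (i, j))"
    unfolding sum_distrib_left mult.assoc by (rule sum.swap)
  also have "\<dots> = (\<Sum>q<n3. (N * N') $$ (k, q) * A ! q $$ (i, j))"
    using N N' k by (intro sum.cong) (auto simp: scalar_prod_def atLeast0LessThan sum_distrib_right)
  also have "\<dots> = mix_slices (N * N') A ! k $$ (i, j)"
    by (simp only: mix_slices_index[OF A k i j])
  finally show "mix_slices N (mix_slices N' A) ! k $$ (i, j) = mix_slices (N * N') A ! k $$ (i, j)" .
qed

lemma mix_slices_one:
  assumes A: "A \<in> tensors n m n3" and n3: "n3 > 0"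
  shows "mix_slices (1\<^sub>m n3) A = A"
proof (rule tensor_eqI[OF mix_slices_in[OF A n3] A])
  fix k i j assume k: "k < n3" and i: "i < n" and j: "j < m"
  have "mix_slices (1\<^sub>m n3) A ! k $$ (i, j) = (\<Sum>l<n3. if l = k then A ! l $$ (i, j) else 0)"
    unfolding mix_slices_index[OF A k i j] using k by (intro sum.cong) auto
  then show "mix_slices (1\<^sub>m n3) A ! k $$ (i, j) = A ! k $$ (i, j)"
    using k by simp
qed

lemma L_trans_eq_mix_slices: "L_trans A = mix_slices (M_mat (length A)) A"
  by (simp add: L_trans_def mix_slices_def)

lemma bij_betw_L_trans:
  assumes n3: "n3 > 0"
  shows "bij_betw L_trans (tensors n m n3) (tensors n m n3)"
proof -
  obtain N where N: "N \<in> carrier_mat n3 n3" "N * M_mat n3 = 1\<^sub>m n3" "M_mat n3 * N = 1\<^sub>m n3"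
    using M_mat_invertible[OF n3] by blast
  have L: "L_trans A = mix_slices (M_mat n3) A" if "A \<in> tensors n m n3" for A
    using that by (simp add: L_trans_eq_mix_slices tensorsD(1))
  show ?thesis
  proof (rule bij_betw_byWitness[of _ "mix_slices N"])
    show "\<forall>A\<in>tensors n m n3. mix_slices N (L_trans A) = A"
      using N n3 by (simp add: L mix_slices_mix_slices mix_slices_one)
    show "\<forall>A\<in>tensors n m n3. L_trans (mix_slices N A) = A"
      using N n3 by (simp add: L mix_slices_in mix_slices_mix_slices mix_slices_one)
  qed (use n3 in \<open>auto simp: L mix_slices_in\<close>)
qed

lemma L_trans_slice_carrier:
  assumes A: "A \<in> tensors n m n3" and i: "i \<in> {1..n3}"
  shows "slice (L_trans A) i \<in> carrier_mat n m"
proof -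
  have "n3 > 0" using i by simp
  then have "L_trans A \<in> tensors n m n3"
    using A mix_slices_in by (simp add: L_trans_eq_mix_slices)
  moreover have "i - 1 < n3" using i by auto
  ultimately show ?thesis unfolding slice_def by (rule tensorsD(2))
qed

text \<open>The C-product, the conjugate transpose and the identity tensor are definite descriptions in terms of
transformed slices; bijectivity of \<open>L_trans\<close> makes all of them meaningful.\<close>

lemma ex1_tensor_L_trans:
  assumes n3: "n3 > 0" and F: "\<And>i. i \<in> {1..n3} \<Longrightarrow> F i \<in> carrier_mat n m"
  shows "\<exists>!C. C \<in> tensors n m n3 \<and> (\<forall>i\<in>{1..n3}. slice (L_trans C) i = F i)"
proof -
  let ?D = "map (\<lambda>l. F (l + 1)) [0..<n3]"
  have D: "?D \<in> tensors n m n3" using F by (auto simp: tensors_def)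
  have iff: "(\<forall>i\<in>{1..n3}. slice (L_trans C) i = F i) \<longleftrightarrow> L_trans C = ?D" if "C \<in> tensors n m n3" for C
  proof -
    have len: "length (L_trans C) = n3"
      using tensorsD(1)[OF that] by (simp add: L_trans_def)
    have "L_trans C = ?D \<longleftrightarrow> (\<forall>l<n3. L_trans C ! l = F (l + 1))"
      unfolding list_eq_iff_nth_eq by (simp add: len)
    also have "\<dots> \<longleftrightarrow> (\<forall>i\<in>{1..n3}. slice (L_trans C) i = F i)"
    proof safe
      fix i assume *: "\<forall>l<n3. L_trans C ! l = F (l + 1)" and i: "i \<in> {1..n3}"
      then show "slice (L_trans C) i = F i"
        by (cases i) (auto simp: slice_def)
    next
      fix l assume "\<forall>i\<in>{1..n3}. slice (L_trans C) i = F i" "l < n3"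
      then show "L_trans C ! l = F (l + 1)"
        by (auto simp: slice_def dest!: bspec[of _ _ "l + 1"])
    qed
    finally show ?thesis by simp
  qed
  from bij_betw_L_trans[OF n3, of n m] D obtain C where "C \<in> tensors n m n3" "L_trans C = ?D"
    by (metis bij_betw_imp_surj_on imageE)
  moreover have "C' = C''" if "C' \<in> tensors n m n3" "C'' \<in> tensors n m n3" "L_trans C' = ?D" "L_trans C'' = ?D" for C' C''
    using that bij_betw_L_trans[OF n3, of n m] by (metis bij_betw_imp_inj_on inj_onD)
  ultimately show ?thesis
    using iff by blast
qed

lemma tensor_eq_of_L_trans_slices:
  assumes n3: "n3 > 0" and A: "A \<in> tensors n m n3" and B: "B \<in> tensors n m n3"
    and eq: "\<And>i. i \<in> {1..n3} \<Longrightarrow> slice (L_trans A) i = slice (L_trans B) i"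
  shows "A = B"
  using ex1_tensor_L_trans[OF n3, of "slice (L_trans B)" n m] L_trans_slice_carrier[OF B] A B eq
  by blast

lemma cprod_tensor:
  assumes n3: "n3 > 0" and A: "A \<in> tensors n m n3" and B: "B \<in> tensors m l n3"
  shows "A *\<^sub>c B \<in> tensors n l n3"
    and "i \<in> {1..n3} \<Longrightarrow> slice (L_trans (A *\<^sub>c B)) i = slice (L_trans A) i * slice (L_trans B) i"
proof -
  have "\<exists>!C. C \<in> tensors n l n3 \<and> (\<forall>i\<in>{1..n3}. slice (L_trans C) i = slice (L_trans A) i * slice (L_trans B) i)"
    by (rule ex1_tensor_L_trans[OF n3]) (rule mult_carrier_mat[OF L_trans_slice_carrier[OF A] L_trans_slice_carrier[OF B]])
  from theI'[OF this]
  show "A *\<^sub>c B \<in> tensors n l n3"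
    and "i \<in> {1..n3} \<Longrightarrow> slice (L_trans (A *\<^sub>c B)) i = slice (L_trans A) i * slice (L_trans B) i"
    unfolding cprod_def trows_tensor[OF A n3] tcols_tensor[OF B n3] tensorsD(1)[OF A] by blast+
qed

lemma ctrans_tensor:
  assumes n3: "n3 > 0" and A: "A \<in> tensors n m n3"
  shows "ctrans A \<in> tensors m n n3"
    and "i \<in> {1..n3} \<Longrightarrow> slice (L_trans (ctrans A)) i = mat_adjoint (slice (L_trans A) i)"
proof -
  have "\<exists>!C. C \<in> tensors m n n3 \<and> (\<forall>i\<in>{1..n3}. slice (L_trans C) i = mat_adjoint (slice (L_trans A) i))"
    by (rule ex1_tensor_L_trans[OF n3]) (use L_trans_slice_carrier[OF A] in auto)
  from theI'[OF this]
  show "ctrans A \<in> tensors m n n3"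
    and "i \<in> {1..n3} \<Longrightarrow> slice (L_trans (ctrans A)) i = mat_adjoint (slice (L_trans A) i)"
    unfolding ctrans_def trows_tensor[OF A n3] tcols_tensor[OF A n3] tensorsD(1)[OF A] by blast+
qed

lemma tid_tensor:
  assumes n3: "n3 > 0"
  shows "tid n n3 \<in> tensors n n n3"
    and "i \<in> {1..n3} \<Longrightarrow> slice (L_trans (tid n n3)) i = 1\<^sub>m n"
proof -
  have "\<exists>!C. C \<in> tensors n n n3 \<and> (\<forall>i\<in>{1..n3}. slice (L_trans C) i = 1\<^sub>m n)"
    by (rule ex1_tensor_L_trans[OF n3]) auto
  from theI'[OF this]
  show "tid n n3 \<in> tensors n n n3"
    and "i \<in> {1..n3} \<Longrightarrow> slice (L_trans (tid n n3)) i = 1\<^sub>m n"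
    unfolding tid_def by blast+
qed

section \<open>The monoid of square tensors\<close>

definition tensor_monoid :: "nat \<Rightarrow> nat \<Rightarrow> tensor monoid" where
  "tensor_monoid n n3 = \<lparr>carrier = tensors n n n3, monoid.mult = (*\<^sub>c), one = tid n n3\<rparr>"

lemma tensor_monoid_simps [simp]:
  "carrier (tensor_monoid n n3) = tensors n n n3"
  "A \<otimes>\<^bsub>tensor_monoid n n3\<^esub> B = A *\<^sub>c B"
  "\<one>\<^bsub>tensor_monoid n n3\<^esub> = tid n n3"
  by (simp_all add: tensor_monoid_def)

text \<open>On transformed slices the operations are the matrix operations, whose laws are carried back by
injectivity of \<open>L_trans\<close>.\<close>

lemma star_monoid_tensor_monoid:
  assumes n3: "n3 > 0"
  shows "star_monoid (tensor_monoid n n3) ctrans"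
proof -
  note ops = cprod_tensor[OF n3, of _ n n _ n] ctrans_tensor[OF n3, of _ n n] tid_tensor[OF n3]
  note carr = L_trans_slice_carrier[of _ n n n3]
  note eqI = tensor_eq_of_L_trans_slices[OF n3, of _ n n]
  have assoc: "A *\<^sub>c B *\<^sub>c C = A *\<^sub>c (B *\<^sub>c C)"
    if "A \<in> tensors n n n3" "B \<in> tensors n n n3" "C \<in> tensors n n n3" for A B C
  proof (rule eqI)
    fix i assume "i \<in> {1..n3}"
    then show "slice (L_trans (A *\<^sub>c B *\<^sub>c C)) i = slice (L_trans (A *\<^sub>c (B *\<^sub>c C))) i"
      using that by (simp add: ops assoc_mult_mat[OF carr carr carr])
  qed (use that in \<open>simp_all add: ops\<close>)
  have one: "tid n n3 *\<^sub>c A = A" "A *\<^sub>c tid n n3 = A" if "A \<in> tensors n n n3" for A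
    by (rule eqI, use that in \<open>simp_all add: ops left_mult_one_mat[OF carr]\<close>)
      (rule eqI, use that in \<open>simp_all add: ops right_mult_one_mat[OF carr]\<close>)
  have inv: "ctrans (ctrans A) = A" if "A \<in> tensors n n n3" for A
    by (rule eqI) (use that in \<open>simp_all add: ops\<close>)
  have anti: "ctrans (A *\<^sub>c B) = ctrans B *\<^sub>c ctrans A"
    if "A \<in> tensors n n n3" "B \<in> tensors n n n3" for A B
    by (rule eqI) (use that in \<open>simp_all add: ops mat_adjoint_mult[OF carr carr]\<close>)
  show ?thesis
    by unfold_locales (simp_all add: ops assoc one inv anti)
qed

lemma tpow_eq_nat_pow:
  assumes n3: "n3 > 0" and A: "A \<in> tensors n n n3"
  shows "A ^\<^sub>c k = A [^]\<^bsub>tensor_monoid n n3\<^esub> k"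
  using trows_tensor[OF A n3] tensorsD(1)[OF A]
  by (induction k) (simp_all add: nat_pow_def)

lemma tpow_tensor:
  assumes n3: "n3 > 0" and A: "A \<in> tensors n n n3"
  shows "A ^\<^sub>c k \<in> tensors n n n3"
    and "i \<in> {1..n3} \<Longrightarrow> slice (L_trans (A ^\<^sub>c k)) i = slice (L_trans A) i ^\<^sub>m k"
proof -
  show in_k: "A ^\<^sub>c k \<in> tensors n n n3" for k
    using trows_tensor[OF A n3] tensorsD(1)[OF A]
    by (induction k) (simp_all add: cprod_tensor[OF n3 _ A] tid_tensor[OF n3])
  show "slice (L_trans (A ^\<^sub>c k)) i = slice (L_trans A) i ^\<^sub>m k" if i: "i \<in> {1..n3}"
    using trows_tensor[OF A n3] tensorsD(1)[OF A] L_trans_slice_carrier[OF A i]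
    by (induction k) (simp_all add: cprod_tensor(2)[OF n3 in_k A i] tid_tensor(2)[OF n3 i])
qed

lemma ex_tensor_slicewise:
  assumes n3: "n3 > 0" and ex: "\<And>i. i \<in> {1..n3} \<Longrightarrow> \<exists>U \<in> carrier_mat n n. P i U"
  shows "\<exists>T \<in> tensors n n n3. \<forall>i\<in>{1..n3}. P i (slice (L_trans T) i)"
proof -
  from ex obtain F where "\<And>i. i \<in> {1..n3} \<Longrightarrow> F i \<in> carrier_mat n n \<and> P i (F i)"
    by metis
  then show ?thesis
    using ex1_tensor_L_trans[OF n3, of F n n] by metis
qed

section \<open>The block Toeplitz-plus-Hankel matrix\<close>

text \<open>The vector \<open>e\<close> has the reflection symmetries \<open>e (- 1 - q) = e q\<close> and
\<open>e (2 * n - 1 - q) = e q\<close>.  The Hankel part of the matrix moves the neighbours \<open>p + l\<close> and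
\<open>p - l\<close> that fall outside \<open>{0..<n}\<close> back into it by just these reflections.  Hence for
\<open>l > 0\<close> the sum is \<open>e (p + l) + e (p - l)\<close>, a multiple of \<open>e p\<close> by the addition theorem,
and \<open>e\<close> is an eigenvector of the matrix that belongs to the single slice \<open>l\<close>.\<close>

lemma sum_cos_toeplitz_hankel:
  fixes i l p n :: nat
  assumes l: "l < n" and p: "p < n"
  defines "e \<equiv> \<lambda>q :: nat. cos (real i * (2 * real q + 1) * pi / (2 * real n))"
  shows "(\<Sum>q<n. e q * (of_bool (\<bar>int q - int p\<bar> = int l) + of_bool (q + p + 1 = l) + of_bool (q + p + l + 1 = 2 * n)))
    = (if l = 0 then 1 else 2) * cos (real i * real l * pi / real n) * e p"
proof (cases "l = 0")
  case True
  have "(\<Sum>q<n. e q * (of_bool (\<bar>int q - int p\<bar> = int l) + of_bool (q + p + 1 = l) + of_bool (q + p + l + 1 = 2 * n)))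
      = (\<Sum>q<n. if q = p then e q else 0)"
    using True p by (intro sum.cong) auto
  then show ?thesis using True p by simp
next
  case False
  define E where "E = (\<lambda>x :: real. cos (real i * (2 * x + 1) * pi / (2 * real n)))"
  have eE: "e q = E (real q)" for q by (simp add: e_def E_def)
  have n: "real n > 0" using l by simp
  have refl0: "E (- 1 - x) = E x" for x
  proof -
    have "real i * (2 * (- 1 - x) + 1) * pi / (2 * real n) = - (real i * (2 * x + 1) * pi / (2 * real n))"
      by (simp add: minus_divide_left algebra_simps)
    then show ?thesis unfolding E_def by (simp only: cos_minus)
  qed
  have refln: "E (2 * real n - 1 - x) = E x" for x
  proof -
    let ?y = "real i * (2 * x + 1) * pi / (2 * real n)"
    have "real i * (2 * (2 * real n - 1 - x) + 1) * pi / (2 * real n)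
        = (real i * pi * 2 * (2 * real n) - real i * (2 * x + 1) * pi) / (2 * real n)"
      by (simp add: algebra_simps)
    also have "\<dots> = 2 * real i * pi - ?y"
      using n by (simp add: diff_divide_distrib)
    finally have "E (2 * real n - 1 - x) = cos (2 * real i * pi - ?y)"
      by (simp add: E_def)
    also have "\<dots> = cos (?y)"
      using cos_2npi[of i] sin_2npi[of i] by (simp add: cos_diff)
    finally show ?thesis by (simp add: E_def)
  qed
  have "(\<Sum>q<n. e q * (of_bool (\<bar>int q - int p\<bar> = int l) + of_bool (q + p + 1 = l) + of_bool (q + p + l + 1 = 2 * n)))
      = (\<Sum>q<n. (if q = p + l then e q else 0) + (if q = p - l then if l \<le> p then e q else 0 else 0)
          + (if q = l - (p + 1) then if p < l then e q else 0 else 0)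
          + (if q = 2 * n - (p + l + 1) then e q else 0))"
  proof (intro sum.cong refl)
    fix q assume "q \<in> {..<n}"
    then have q: "q < n" by simp
    have iff: "(\<bar>int q - int p\<bar> = int l) = (q = p + l \<or> (q = p - l \<and> l \<le> p))"
        "(q + p + 1 = l) = (q = l - (p + 1) \<and> p < l)"
        "(q + p + l + 1 = 2 * n) = (q = 2 * n - (p + l + 1))"
      using l p by linarith+
    have excl: "\<not> (q = p + l \<and> q = p - l \<and> l \<le> p)"
      using False by linarith
    have split: "x * (of_bool (a \<or> (b \<and> c)) + of_bool (d \<and> f) + of_bool g)
        = (if a then x else 0) + (if b then if c then x else 0 else 0)
          + (if d then if f then x else 0 else 0) + (if g then x else 0)"
      if "\<not> (a \<and> b \<and> c)" for a b c d f g and x :: real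
      using that by (simp add: of_bool_def distrib_left)
    show "e q * (of_bool (\<bar>int q - int p\<bar> = int l) + of_bool (q + p + 1 = l) + of_bool (q + p + l + 1 = 2 * n))
      = (if q = p + l then e q else 0) + (if q = p - l then if l \<le> p then e q else 0 else 0)
          + (if q = l - (p + 1) then if p < l then e q else 0 else 0)
          + (if q = 2 * n - (p + l + 1) then e q else 0)"
      unfolding iff by (rule split[OF excl])
  qed
  also have "\<dots> = (if p + l < n then e (p + l) else 0) + (if l \<le> p then e (p - l) else 0)
      + (if p < l then e (l - (p + 1)) else 0) + (if 2 * n - (p + l + 1) < n then e (2 * n - (p + l + 1)) else 0)"
  proof -
    have "p - l < n" "l - (p + 1) < n" using l p by auto
    then show ?thesis unfolding sum.distrib by (simp add: sum.delta')
  qed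
  also have "\<dots> = E (real p + real l) + E (real p - real l)"
  proof -
    have 1: "(if l \<le> p then e (p - l) else 0) + (if p < l then e (l - (p + 1)) else 0) = E (real p - real l)"
    proof (cases "l \<le> p")
      case True
      then show ?thesis by (simp add: eE of_nat_diff)
    next
      case False
      then have "real (l - (p + 1)) = - 1 - (real p - real l)"
        by (simp add: of_nat_diff)
      then have "e (l - (p + 1)) = E (real p - real l)"
        unfolding eE by (simp only: refl0)
      then show ?thesis using False by simp
    qed
    have 2: "(if p + l < n then e (p + l) else 0) + (if 2 * n - (p + l + 1) < n then e (2 * n - (p + l + 1)) else 0)
        = E (real p + real l)"
    proof (cases "p + l < n")
      case True
      then show ?thesis by (simp add: eE)
    next
      case False
      then have "real (2 * n - (p + l + 1)) = 2 * real n - 1 - (real p + real l)"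
        using l p by (simp add: of_nat_diff)
      then have "e (2 * n - (p + l + 1)) = E (real p + real l)"
        unfolding eE by (simp only: refln)
      moreover have "2 * n - (p + l + 1) < n" using False l p by linarith
      ultimately show ?thesis using False by simp
    qed
    show ?thesis using 1 2 by linarith
  qed
  also have "\<dots> = 2 * cos (real i * real l * pi / real n) * E (real p)"
  proof -
    let ?a = "real i * (2 * real p + 1) * pi / (2 * real n)" and ?b = "real i * real l * pi / real n"
    have "real i * (2 * (real p + real l) + 1) * pi / (2 * real n) = ?a + ?b"
      by (simp add: add_divide_distrib algebra_simps)
    moreover have "real i * (2 * (real p - real l) + 1) * pi / (2 * real n) = ?a - ?b"
      by (simp add: add_divide_distrib diff_divide_distrib algebra_simps)
    moreover have "cos (?a + ?b) + cos (?a - ?b) = 2 * cos ?b * cos ?a"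
      unfolding cos_add cos_diff by simp
    ultimately show ?thesis
      unfolding E_def by simp
  qed
  finally show ?thesis using False by (simp add: eE)
qed

text \<open>The three cases of \<open>H_block\<close> merge into two indicators: on the antidiagonal
\<open>q + p + 1 = n3\<close>, where the Hankel part is zero, neither of them holds for any \<open>l < n3\<close>.\<close>

lemma tmat_block_index:
  assumes A: "A \<in> tensors n m n3" and p: "p < n3" and q: "q < n3" and r: "r < n" and c: "c < m"
  shows "tmat_block A (q + 1) (p + 1) $$ (r, c)
    = (\<Sum>l<n3. of_real (of_bool (\<bar>int q - int p\<bar> = int l) + of_bool (q + p + 1 = l) + of_bool (q + p + l + 1 = 2 * n3))
        * A ! l $$ (r, c))"
proof -
  have n3: "n3 > 0" using p by simp
  have len: "length A = n3" by (rule tensorsD(1)[OF A])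
  let ?a = "\<lambda>l. A ! l $$ (r, c)"
  let ?d = "nat \<bar>int q - int p\<bar>"
  have d: "?d < n3" using p q by linarith
  have "(\<Sum>l<n3. of_real (of_bool (\<bar>int q - int p\<bar> = int l) + of_bool (q + p + 1 = l) + of_bool (q + p + l + 1 = 2 * n3)) * ?a l)
     = (\<Sum>l<n3. (if l = ?d then ?a l else 0) + (if l = q + p + 1 then ?a l else 0)
          + (if l = 2 * n3 - (q + p + 1) then ?a l else 0))"
  proof (intro sum.cong refl)
    fix l assume "l \<in> {..<n3}"
    have "(\<bar>int q - int p\<bar> = int l) = (l = ?d)" by auto
    moreover have "(q + p + l + 1 = 2 * n3) = (l = 2 * n3 - (q + p + 1))" using p q by auto
    moreover have "(q + p + 1 = l) = (l = q + p + 1)" by auto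
    ultimately show "of_real (of_bool (\<bar>int q - int p\<bar> = int l) + of_bool (q + p + 1 = l) + of_bool (q + p + l + 1 = 2 * n3)) * ?a l
       = (if l = ?d then ?a l else 0) + (if l = q + p + 1 then ?a l else 0)
          + (if l = 2 * n3 - (q + p + 1) then ?a l else 0)"
      by (simp add: of_bool_def distrib_right)
  qed
  also have "\<dots> = ?a ?d + (if q + p + 1 < n3 then ?a (q + p + 1) else 0)
      + (if 2 * n3 - (q + p + 1) < n3 then ?a (2 * n3 - (q + p + 1)) else 0)"
    unfolding sum.distrib using d by (simp add: sum.delta')
  also have "\<dots> = ?a ?d + H_block A (q + 1) (p + 1) $$ (r, c)"
  proof -
    consider "q + p + 2 \<le> n3" | "q + p + 1 = n3" | "q + p + 1 > n3" by linarith
    then show ?thesis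
    proof cases
      case 1
      then show ?thesis by (simp add: H_block_def len slice_def)
    next
      case 2
      then show ?thesis using r c trows_tensor[OF A n3] tcols_tensor[OF A n3]
        by (simp add: H_block_def len Let_def)
    next
      case 3
      then have "2 * n3 + 2 - (q + 1) - (p + 1) - 1 = 2 * n3 - (q + p + 1)" "2 * n3 - (q + p + 1) < n3"
        using p q by auto
      then show ?thesis using 3 by (simp add: H_block_def len slice_def Let_def)
    qed
  qed
  also have "\<dots> = tmat_block A (q + 1) (p + 1) $$ (r, c)"
  proof -
    have "H_block A (q + 1) (p + 1) \<in> carrier_mat n m"
    proof -
      consider "q + p + 2 \<le> n3" | "q + p + 1 = n3" | "q + p + 1 > n3" by linarith
      then show ?thesis
      proof cases
        case 1
        then show ?thesis using tensorsD(2)[OF A, of "q + p + 1"] by (simp add: H_block_def len slice_def)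
      next
        case 2
        then show ?thesis using trows_tensor[OF A n3] tcols_tensor[OF A n3]
          by (simp add: H_block_def len Let_def)
      next
        case 3
        then have "2 * n3 + 2 - (q + 1) - (p + 1) - 1 = 2 * n3 - (q + p + 1)" "2 * n3 - (q + p + 1) < n3"
          using p q by auto
        then show ?thesis using 3 tensorsD(2)[OF A, of "2 * n3 - (q + p + 1)"]
          by (simp add: H_block_def len slice_def Let_def)
      qed
    qed
    then show ?thesis using r c by (simp add: tmat_block_def slice_def)
  qed
  finally show ?thesis by simp
qed

text \<open>The Kronecker product of row \<open>i\<close> of \<open>dct_rows\<close> with the identity matrix of size \<open>n\<close>.\<close>

definition dct_block_row :: "nat \<Rightarrow> nat \<Rightarrow> nat \<Rightarrow> complex mat" where
  "dct_block_row n n3 i = mat n (n * n3) (\<lambda>(r, s). if s mod n = r then dct_rows n3 $$ (i, s div n) else 0)"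

lemma sum_mod_class:
  fixes f :: "nat \<Rightarrow> 'a :: comm_monoid_add"
  assumes r: "r < n"
  shows "(\<Sum>t<n * k. if t mod n = r then f t else 0) = (\<Sum>q<k. f (q * n + r))"
proof -
  have "(\<Sum>t<n * k. if t mod n = r then f t else 0) = sum f {t \<in> {..<n * k}. t mod n = r}"
    by (rule sum.inter_filter[symmetric]) simp
  also have "\<dots> = (\<Sum>q<k. f (q * n + r))"
  proof (rule sum.reindex_bij_witness[of _ "\<lambda>q. q * n + r" "\<lambda>t. t div n"])
    fix q assume "q \<in> {..<k}"
    then have "q + 1 \<le> k" by simp
    then have "(q + 1) * n \<le> k * n" by (rule mult_le_mono1)
    then show "q * n + r \<in> {t \<in> {..<n * k}. t mod n = r}"
      using r by (simp add: algebra_simps)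
  next
    fix t assume t: "t \<in> {t \<in> {..<n * k}. t mod n = r}"
    then show "t div n \<in> {..<k}"
      by (simp add: less_mult_imp_div_less mult.commute)
    show "t div n * n + r = t" using t div_mult_mod_eq[of t n] by simp
  qed (use r in auto)
  finally show ?thesis .
qed

text \<open>Row \<open>i\<close> of \<open>dct_rows\<close> is an eigenvector of the coefficient matrix of each slice
\<open>l\<close>, with eigenvalue the entry \<open>(i, l)\<close> of \<open>M_mat\<close>; summation over \<open>l\<close> with the
slices as weights produces the transformed slice.\<close>

lemma dct_block_row_intertwines:
  assumes A: "A \<in> tensors n n n3" and n: "n > 0" and i: "i < n3"
  shows "dct_block_row n n3 i * tmat A = slice (L_trans A) (i + 1) * dct_block_row n n3 i"
    (is "?F * ?T = ?L * ?F")
proof (rule eq_matI)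
  have n3: "n3 > 0" using i by simp
  note dims = trows_tensor[OF A n3] tcols_tensor[OF A n3] tensorsD(1)[OF A]
  have L: "?L \<in> carrier_mat n n" using L_trans_slice_carrier[OF A, of "i + 1"] i by simp
  have T: "?T \<in> carrier_mat (n * n3) (n * n3)" by (simp add: tmat_def dims)
  show "dim_row (?F * ?T) = dim_row (?L * ?F)" "dim_col (?F * ?T) = dim_col (?L * ?F)"
    using L T by (simp_all add: dct_block_row_def)
  fix r s assume "r < dim_row (?L * ?F)" "s < dim_col (?L * ?F)"
  then have r: "r < n" and s: "s < n * n3" using L by (simp_all add: dct_block_row_def)
  define p where "p = s div n"
  define c where "c = s mod n"
  have p: "p < n3" using s by (simp add: p_def less_mult_imp_div_less mult.commute)
  have c: "c < n" using n by (simp add: c_def)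
  let ?K = "\<lambda>l q. of_bool (\<bar>int q - int p\<bar> = int l) + of_bool (q + p + 1 = l) + of_bool (q + p + l + 1 = 2 * n3) :: real"
  let ?e = "\<lambda>q. cos (real i * (2 * real q + 1) * pi / (2 * real n3))"
  let ?c = "\<lambda>q. ?e q / cos (real i * pi / (2 * real n3))"
  have rows: "dct_rows n3 $$ (i, q) = complex_of_real (?c q)" if "q < n3" for q
    using that i by (simp add: dct_rows_def)
  have eig: "(\<Sum>q<n3. ?c q * ?K l q) = (if l = 0 then 1 else 2) * cos (real i * real l * pi / real n3) * ?c p"
    if "l < n3" for l
  proof -
    have "(\<Sum>q<n3. ?c q * ?K l q) = (\<Sum>q<n3. ?e q * ?K l q) / cos (real i * pi / (2 * real n3))"
      by (simp add: sum_divide_distrib)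
    then show ?thesis
      unfolding sum_cos_toeplitz_hankel[OF that p] by simp
  qed
  have "(?F * ?T) $$ (r, s) = (\<Sum>t<n * n3. ?F $$ (r, t) * ?T $$ (t, s))"
    using r s T by (auto simp: scalar_prod_def atLeast0LessThan dct_block_row_def intro!: sum.cong)
  also have "\<dots> = (\<Sum>t<n * n3. if t mod n = r then dct_rows n3 $$ (i, t div n) * tmat_block A (t div n + 1) (p + 1) $$ (t mod n, c) else 0)"
    using r s by (intro sum.cong) (auto simp: dct_block_row_def tmat_def dims p_def c_def)
  also have "\<dots> = (\<Sum>q<n3. dct_rows n3 $$ (i, q) * tmat_block A (q + 1) (p + 1) $$ (r, c))"
    unfolding sum_mod_class[OF r] using r by simp
  also have "\<dots> = (\<Sum>q<n3. \<Sum>l<n3. complex_of_real (?c q * ?K l q) * A ! l $$ (r, c))"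
    by (intro sum.cong refl) (simp only: tmat_block_index[OF A p _ r c] rows sum_distrib_left mult.assoc of_real_mult lessThan_iff)
  also have "\<dots> = (\<Sum>l<n3. complex_of_real (\<Sum>q<n3. ?c q * ?K l q) * A ! l $$ (r, c))"
    unfolding of_real_sum sum_distrib_right by (rule sum.swap)
  also have "\<dots> = (\<Sum>l<n3. M_mat n3 $$ (i, l) * A ! l $$ (r, c)) * complex_of_real (?c p)"
    unfolding sum_distrib_right
    by (intro sum.cong refl) (simp only: eig M_mat_index[OF i] of_real_mult lessThan_iff, simp only: mult_ac)
  also have "(\<Sum>l<n3. M_mat n3 $$ (i, l) * A ! l $$ (r, c)) = ?L $$ (r, c)"
    using mix_slices_index[OF A i r c, of "M_mat n3"] dims by (simp add: slice_def L_trans_eq_mix_slices)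
  also have "?L $$ (r, c) * complex_of_real (?c p) = (\<Sum>t<n. if t = c then ?L $$ (r, t) * dct_rows n3 $$ (i, p) else 0)"
    using c by (simp add: rows[OF p])
  also have "\<dots> = (\<Sum>t<n. ?L $$ (r, t) * ?F $$ (t, s))"
    using s by (intro sum.cong) (auto simp: dct_block_row_def p_def c_def)
  also have "\<dots> = (?L * ?F) $$ (r, s)"
    using r s L by (auto simp: scalar_prod_def atLeast0LessThan dct_block_row_def intro!: sum.cong)
  finally show "(?F * ?T) $$ (r, s) = (?L * ?F) $$ (r, s)" .
qed

text \<open>The first block of the row is an identity matrix.\<close>

lemma dct_block_row_right_inverse:
  assumes n: "n > 0" and i: "i < n3"
  shows "\<exists>R \<in> carrier_mat (n * n3) n. dct_block_row n n3 i * R = 1\<^sub>m n"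
proof -
  let ?R = "mat (n * n3) n (\<lambda>(s, c). if s = c then 1 else 0) :: complex mat"
  have "dct_block_row n n3 i * ?R = 1\<^sub>m n"
  proof (rule eq_matI)
    fix r c assume "r < dim_row (1\<^sub>m n :: complex mat)" "c < dim_col (1\<^sub>m n :: complex mat)"
    then have r: "r < n" and c: "c < n" by simp_all
    have c': "c < n * n3" using c i by (metis less_le_trans mult.right_neutral mult_le_mono2 Suc_leI One_nat_def gr_implies_not0 not_gr_zero)
    have "(dct_block_row n n3 i * ?R) $$ (r, c) = (\<Sum>s<n * n3. dct_block_row n n3 i $$ (r, s) * ?R $$ (s, c))"
      using r c by (simp add: scalar_prod_def atLeast0LessThan dct_block_row_def)
    also have "\<dots> = (\<Sum>s<n * n3. if s = c then dct_block_row n n3 i $$ (r, s) else 0)"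
      using c by (intro sum.cong) auto
    also have "\<dots> = dct_block_row n n3 i $$ (r, c)"
      using c' by simp
    also have "\<dots> = 1\<^sub>m n $$ (r, c)"
      using r c c' i cos_half_range_pos[OF i] by (auto simp: dct_block_row_def dct_rows_def)
    finally show "(dct_block_row n n3 i * ?R) $$ (r, c) = 1\<^sub>m n $$ (r, c)" .
  qed (simp_all add: dct_block_row_def)
  then show ?thesis by (intro bexI[of _ ?R]) auto
qed

lemma intertwine_pow_mat:
  fixes F :: "'a :: semiring_1 mat"
  assumes F: "F \<in> carrier_mat n m" and T: "T \<in> carrier_mat m m" and L: "L \<in> carrier_mat n n"
    and eq: "F * T = L * F"
  shows "F * T ^\<^sub>m k = L ^\<^sub>m k * F"
proof (induction k)
  case (Suc k)
  have "F * T ^\<^sub>m Suc k = F * T ^\<^sub>m k * T"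
    using F T assoc_mult_mat[OF F pow_carrier_mat[OF T] T, of k] by simp
  also have "\<dots> = L ^\<^sub>m k * (F * T)"
    unfolding Suc using assoc_mult_mat[OF pow_carrier_mat[OF L] F T, of k] by simp
  also have "\<dots> = L ^\<^sub>m Suc k * F"
    unfolding eq using assoc_mult_mat[OF pow_carrier_mat[OF L] L F, of k] by simp
  finally show ?case .
qed (use F T L in simp)

text \<open>At the index the ranks of consecutive powers of \<open>tmat A\<close> agree, so
\<open>tmat A ^ k = tmat A ^ (k + 1) * U\<close>.  The intertwining relation carries this factorisation to
the transformed slice, because the block row has a right inverse.\<close>

lemma L_trans_slice_pow_factor:
  assumes A: "A \<in> tensors n n n3" and n: "n > 0" and i: "i \<in> {1..n3}" and k: "k = tensor_index A"
  shows "\<exists>U \<in> carrier_mat n n. slice (L_trans A) i ^\<^sub>m k = slice (L_trans A) i ^\<^sub>m (k + 1) * U"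
proof -
  have n3: "n3 > 0" and i': "i - 1 < n3" "i - 1 + 1 = i" using i by auto
  let ?T = "tmat A" and ?F = "dct_block_row n n3 (i - 1)" and ?L = "slice (L_trans A) i"
  have T: "?T \<in> carrier_mat (n * n3) (n * n3)"
    by (simp add: tmat_def trows_tensor[OF A n3] tcols_tensor[OF A n3] tensorsD(1)[OF A])
  have F: "?F \<in> carrier_mat n (n * n3)" by (simp add: dct_block_row_def)
  have L: "?L \<in> carrier_mat n n" by (rule L_trans_slice_carrier[OF A i])
  \<comment> \<open>The least number in the definition of the index exists because the ranks of powers stabilise.\<close>
  have "vec_space.rank (n * n3) (?T ^\<^sub>m k) = vec_space.rank (n * n3) (?T ^\<^sub>m (k + 1))"
    using LeastI_ex[OF ex_rank_pow_mat_eq[OF T]] T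
    unfolding k tensor_index_def mat_index_def by simp
  then obtain U where U: "U \<in> carrier_mat (n * n3) (n * n3)" and TU: "?T ^\<^sub>m k = ?T ^\<^sub>m (k + 1) * U"
    using pow_mat_factor_of_rank_eq[OF T] by blast
  obtain R where R: "R \<in> carrier_mat (n * n3) n" and FR: "?F * R = 1\<^sub>m n"
    using dct_block_row_right_inverse[OF n i'(1)] by blast
  have FT: "?F * ?T ^\<^sub>m j = ?L ^\<^sub>m j * ?F" for j
    using intertwine_pow_mat[OF F T L] dct_block_row_intertwines[OF A n i'(1)] unfolding i'(2) by blast
  have "?L ^\<^sub>m k = ?L ^\<^sub>m k * (?F * R)"
    unfolding FR using L by simp
  also have "\<dots> = ?F * ?T ^\<^sub>m k * R"
    unfolding FT by (rule assoc_mult_mat[OF pow_carrier_mat[OF L] F R, symmetric])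
  also have "\<dots> = ?F * ?T ^\<^sub>m (k + 1) * U * R"
    unfolding assoc_mult_mat[OF F pow_carrier_mat[OF T] U] TU[symmetric] ..
  also have "\<dots> = ?L ^\<^sub>m (k + 1) * (?F * U * R)"
  proof -
    note Lk = pow_carrier_mat[OF L, of "k + 1"]
    have FU: "?F * U \<in> carrier_mat n (n * n3)" using F U by simp
    show ?thesis
      unfolding FT assoc_mult_mat[OF Lk F U] assoc_mult_mat[OF Lk FU R] ..
  qed
  finally show ?thesis
    using F U R by (intro bexI[of _ "?F * U * R"]) auto
qed

section \<open>Generalised inverses of tensors\<close>

text \<open>The right factorisation comes from the index of \<open>tmat A\<close>.  For the left one, each transformed
  slice has some power with a left factorisation, and the lemma \<open>pow_eq_mult_pow_reduce\<close> brings it to the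
  exponent \<open>k\<close>.\<close>

lemma tensor_pow_factors:
  assumes n: "n > 0" and n3: "n3 > 0" and A: "A \<in> tensors n n n3" and k: "k = tensor_index A"
  shows "\<exists>u \<in> tensors n n n3. A ^\<^sub>c k = A ^\<^sub>c (k + 1) *\<^sub>c u"
    and "\<exists>v \<in> tensors n n n3. A ^\<^sub>c k = v *\<^sub>c A ^\<^sub>c (k + 1)"
proof -
  note pow_in = tpow_tensor(1)[OF n3 A] and pow_slice = tpow_tensor(2)[OF n3 A]
  note prod_slice = cprod_tensor(2)[OF n3] and prod_in = cprod_tensor(1)[OF n3]
  note eqI = tensor_eq_of_L_trans_slices[OF n3, of _ n n]
  let ?B = "\<lambda>i. slice (L_trans A) i"
  obtain u where u: "u \<in> tensors n n n3"
    and u_slice: "\<forall>i\<in>{1..n3}. ?B i ^\<^sub>m k = ?B i ^\<^sub>m (k + 1) * slice (L_trans u) i"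
    using ex_tensor_slicewise[OF n3, of n "\<lambda>i U. ?B i ^\<^sub>m k = ?B i ^\<^sub>m (k + 1) * U"]
      L_trans_slice_pow_factor[OF A n _ k] by blast
  have "A ^\<^sub>c k = A ^\<^sub>c (k + 1) *\<^sub>c u"
    by (rule eqI) (use u_slice in \<open>simp_all only: pow_in prod_in[OF pow_in u] prod_slice[OF pow_in u] pow_slice\<close>)
  with u show "\<exists>u \<in> tensors n n n3. A ^\<^sub>c k = A ^\<^sub>c (k + 1) *\<^sub>c u" by blast
  have "\<exists>V \<in> carrier_mat n n. ?B i ^\<^sub>m k = V * ?B i ^\<^sub>m (k + 1)" if i: "i \<in> {1..n3}" for i
  proof -
    let ?R = "ring_mat TYPE(complex) n ()"
    interpret R: ring ?R by (rule ring_mat)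
    have Bi: "?B i \<in> carrier_mat n n" by (rule L_trans_slice_carrier[OF A i])
    note pow = pow_mat_ring_pow[OF Bi, of _ "()"]
    obtain m V where V: "V \<in> carrier_mat n n" "?B i ^\<^sub>m m = V * ?B i ^\<^sub>m (m + 1)"
      using ex_pow_mat_factor(2)[OF Bi] by blast
    obtain U where U: "U \<in> carrier_mat n n" "?B i ^\<^sub>m k = ?B i ^\<^sub>m (k + 1) * U"
      using L_trans_slice_pow_factor[OF A n i k] by blast
    have "?B i ^\<^sub>m k = V * ?B i ^\<^sub>m (k + 1)"
      using R.pow_eq_mult_pow_reduce[of "?B i" U V k m] Bi U V
      unfolding pow ring_mat_simps by blast
    with V(1) show ?thesis by blast
  qed
  then obtain v where v: "v \<in> tensors n n n3"
    and v_slice: "\<forall>i\<in>{1..n3}. ?B i ^\<^sub>m k = slice (L_trans v) i * ?B i ^\<^sub>m (k + 1)"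
    using ex_tensor_slicewise[OF n3, of n "\<lambda>i V. ?B i ^\<^sub>m k = V * ?B i ^\<^sub>m (k + 1)"] by blast
  have "A ^\<^sub>c k = v *\<^sub>c A ^\<^sub>c (k + 1)"
    by (rule eqI) (use v_slice in \<open>simp_all only: pow_in prod_in[OF v pow_in] prod_slice[OF v pow_in] pow_slice\<close>)
  with v show "\<exists>v \<in> tensors n n n3. A ^\<^sub>c k = v *\<^sub>c A ^\<^sub>c (k + 1)" by blast
qed

text \<open>Every transformed slice admits the factorisations of \<open>is_mp_of_star_regular\<close>, and these
  assemble to tensors \<open>p\<close> and \<open>q\<close>.\<close>

lemma is_mp_inverse_mp_inverse:
  assumes n3: "n3 > 0" and B: "B \<in> tensors n n n3"
  shows "is_mp_inverse B (mp_inverse B)"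
proof -
  let ?G = "tensor_monoid n n3"
  interpret star_monoid ?G ctrans
    by (rule star_monoid_tensor_monoid[OF n3])
  note prod_slice = cprod_tensor(2)[OF n3] and prod_in = cprod_tensor(1)[OF n3]
  note eqI = tensor_eq_of_L_trans_slices[OF n3, of _ n n]
  have mp_iff: "is_mp_inverse B X \<longleftrightarrow> is_mp B X" for X
    by (simp only: is_mp_inverse_def is_mp_def trows_tensor[OF B n3] tcols_tensor[OF B n3]
        tensorsD(1)[OF B] tensor_monoid_simps)
  let ?C = "\<lambda>i. slice (L_trans B) i"
  have Ci: "?C i \<in> carrier_mat n n" if "i \<in> {1..n3}" for i
    by (rule L_trans_slice_carrier[OF B that])
  note B' = ctrans_tensor[OF n3 B]
  obtain p where p: "p \<in> tensors n n n3"
    and p_slice: "\<forall>i\<in>{1..n3}. ?C i = slice (L_trans p) i * (mat_adjoint (?C i) * ?C i)"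
    using ex_tensor_slicewise[OF n3, of n "\<lambda>i P. ?C i = P * (mat_adjoint (?C i) * ?C i)"]
      ex_star_regular_left[OF Ci] by blast
  obtain q where q: "q \<in> tensors n n n3"
    and q_slice: "\<forall>i\<in>{1..n3}. ?C i = ?C i * mat_adjoint (?C i) * slice (L_trans q) i"
    using ex_tensor_slicewise[OF n3, of n "\<lambda>i Q. ?C i = ?C i * mat_adjoint (?C i) * Q"]
      ex_star_regular_right[OF Ci] by blast
  have "B = p *\<^sub>c (ctrans B *\<^sub>c B)"
  proof (rule eqI)
    fix i assume i: "i \<in> {1..n3}"
    show "?C i = slice (L_trans (p *\<^sub>c (ctrans B *\<^sub>c B))) i"
      by (rule trans[OF bspec[OF p_slice i]])
        (simp only: prod_slice[OF p prod_in[OF B'(1) B] i] prod_slice[OF B'(1) B i] B'(2)[OF i])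
  qed (rule B prod_in[OF p prod_in[OF B'(1) B]])+
  moreover have "B = B *\<^sub>c ctrans B *\<^sub>c q"
  proof (rule eqI)
    fix i assume i: "i \<in> {1..n3}"
    show "?C i = slice (L_trans (B *\<^sub>c ctrans B *\<^sub>c q)) i"
      by (rule trans[OF bspec[OF q_slice i]])
        (simp only: prod_slice[OF prod_in[OF B B'(1)] q i] prod_slice[OF B B'(1) i] B'(2)[OF i])
  qed (rule B prod_in[OF prod_in[OF B B'(1)] q])+
  ultimately have ex: "is_mp B (ctrans q *\<^sub>c B *\<^sub>c ctrans p)"
    by (rule is_mp_of_star_regular[unfolded tensor_monoid_simps, OF B p q])
  have B_in: "B \<in> carrier ?G" unfolding tensor_monoid_simps by (rule B)
  show ?thesis
    unfolding mp_inverse_def mp_iff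
    by (rule theI[where P = "is_mp B", OF ex]) (rule is_mp_unique[OF B_in _ ex])
qed

theorem theorem4p1:
  fixes A :: tensor and n1 n3 k :: nat
  assumes "n1 \<ge> 1" and "n3 \<ge> 1"
    and "A \<in> tensors n1 n1 n3"
    and "tensor_index A = k"
  shows "(\<forall>X. is_one_inverse (A ^\<^sub>c (2 * k + 1)) X \<longrightarrow>
            drazin_inverse A = A ^\<^sub>c k *\<^sub>c X *\<^sub>c A ^\<^sub>c k) \<and>
         drazin_inverse A = A ^\<^sub>c k *\<^sub>c mp_inverse (A ^\<^sub>c (2 * k + 1)) *\<^sub>c A ^\<^sub>c k"
proof -
  have n: "n1 > 0" and n3: "n3 > 0" using assms by simp_all
  note A = assms(3)
  let ?G = "tensor_monoid n1 n3" and ?b = "A ^\<^sub>c (2 * k + 1)"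
  interpret star_monoid ?G ctrans
    by (rule star_monoid_tensor_monoid[OF n3])
  note dims = trows_tensor[OF _ n3] tcols_tensor[OF _ n3] tensorsD(1)
  note pow_in = tpow_tensor(1)[OF n3 A]
  note pow_eq = tpow_eq_nat_pow[OF n3 A]
  obtain u v where u: "u \<in> tensors n1 n1 n3" and v: "v \<in> tensors n1 n1 n3"
    and right: "A [^]\<^bsub>?G\<^esub> k = A [^]\<^bsub>?G\<^esub> (k + 1) \<otimes>\<^bsub>?G\<^esub> u"
    and left: "A [^]\<^bsub>?G\<^esub> k = v \<otimes>\<^bsub>?G\<^esub> A [^]\<^bsub>?G\<^esub> (k + 1)"
    using tensor_pow_factors[OF n n3 A assms(4)[symmetric]]
    unfolding pow_eq tensor_monoid_simps by blast
  have drazin_iff: "is_drazin_inverse A X \<longleftrightarrow> is_drazin k A X" for X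
    by (simp add: is_drazin_inverse_def is_drazin_def assms(4) dims[OF A] pow_eq del: tpow.simps nat_pow_Suc)
  have formula: "drazin_inverse A = A ^\<^sub>c k *\<^sub>c X *\<^sub>c A ^\<^sub>c k" if X: "is_one_inverse ?b X" for X
  proof -
    have Xc: "X \<in> tensors n1 n1 n3" and bXb: "?b *\<^sub>c X *\<^sub>c ?b = ?b"
      using X by (simp_all only: is_one_inverse_def dims[OF pow_in])
    have "is_drazin k A (A [^]\<^bsub>?G\<^esub> k \<otimes>\<^bsub>?G\<^esub> X \<otimes>\<^bsub>?G\<^esub> A [^]\<^bsub>?G\<^esub> k)"
      by (rule is_drazin_one_inverse[OF _ _ _ _ right left])
        (use A u v Xc bXb in \<open>simp_all only: tensor_monoid_simps pow_eq\<close>)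
    then have "is_drazin k A (A ^\<^sub>c k *\<^sub>c X *\<^sub>c A ^\<^sub>c k)"
      by (simp only: tensor_monoid_simps pow_eq)
    then show ?thesis
      unfolding drazin_inverse_def drazin_iff
      using is_drazin_unique[of A k] A by (intro the_equality) auto
  qed
  have "is_one_inverse ?b (mp_inverse ?b)"
    using is_mp_inverse_mp_inverse[OF n3 pow_in]
    by (simp only: is_mp_inverse_def is_one_inverse_def)
  with formula show ?thesis by blast
qed

end
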